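(* Let $a,b>0$ and let $g\in L^2(\mathbb{R})$ be a preframe function for the parameters $a,b$ (i.e. $g\in\mathbf{PF}$). The following are equivalent: (1) The Walnut series converges in norm for every $f\in L^2(\mathbb{R})$, i.e. $\lim_{K,L\to\infty}S_{K,L}f$ exists in the norm of $L^2(\mathbb{R})$. (2) The Walnut series converges weakly for every $f\in L^2(\mathbb{R})$, i.e. $\lim_{K,L\to\infty}S_{K,L}f$ exists in the weak topology of $L^2(\mathbb{R})$. (3) $\sup_{K,L}\|S_{K,L}\|<\infty$. (4) For all $f\in L^2(\mathbb{R})$, $$\lim_{K,L\to\infty}\frac1b\langle S_{K,L}f,f\rangle=\langle Sf,f\rangle .$$ (5) For all $f\in L^2(\mathbb{R})$, $$\sum_{m,n\in\mathbb{Z}}|\langle f,E_{mb}T_{na}g\rangle|^2=\lim_{K,L\to\infty}\frac1b\sum_{k=-L}^{K}\int_{\mathbb{R}}\overline{f(t)}f(t-k/b)G_k(t)\,dt .$$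
   Context: For $c\in\mathbb{R}$ let $T_cf(x)=f(x-c)$ and $E_cf(x)=e^{2\pi i c x}f(x)$. $g\in\mathbf{PF}$ means that $(g,a,b)=(E_{mb}T_{na}g)_{m,n\in\mathbb{Z}}$ has a finite upper frame bound: there is $B<\infty$ with $\sum_{m,n\in\mathbb{Z}}|\langle f,E_{mb}T_{na}g\rangle|^2\le B\|f\|^2$ for all $f\in L^2(\mathbb{R})$. Equivalently, $Sf=\sum_{m,n\in\mathbb{Z}}\langle f,E_{mb}T_{na}g\rangle E_{mb}T_{na}g$ is a well-defined bounded linear operator on $L^2(\mathbb{R})$. For $k\in\mathbb{Z}$ put $G_k(t)=\sum_{n\in\mathbb{Z}}g(t-na)\overline{g(t-na-k/b)}$. For integers $K,L$ and $f\in L^2(\mathbb{R})$ let $S_{K,L}f(t)=\sum_{k=-L}^{K}f(t-k/b)G_k(t)$, and let $\|S_{K,L}\|$ be its operator norm on $L^2(\mathbb{R})$. The Walnut series of $f$ is $\frac1b\sum_{k\in\mathbb{Z}}(T_{k/b}f)G_k$. In $\lim_{K,L\to\infty}$ the indices $K$ and $L$ tend to infinity independently. *)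

theory Defs
  imports "HOL-Analysis.Analysis"
begin

text \<open>Elements of \<open>L\<^sup>2(\<real>)\<close> are represented by Borel functions, not by equivalence classes:
  \<open>L2_norm\<close> is therefore only a seminorm, and limits are unique only almost everywhere.\<close>

definition L2 :: "(real \<Rightarrow> complex) set" where
  "L2 = {f \<in> borel_measurable lborel. integrable lborel (\<lambda>t. (cmod (f t))\<^sup>2)}"

definition L2_norm :: "(real \<Rightarrow> complex) \<Rightarrow> real" where
  "L2_norm f = sqrt (LINT t|lborel. (cmod (f t))\<^sup>2)"

definition L2_inner :: "(real \<Rightarrow> complex) \<Rightarrow> (real \<Rightarrow> complex) \<Rightarrow> complex" where
  "L2_inner f h = (LINT t|lborel. f t * cnj (h t))"

text \<open>The explicit membership conditions below are there because the Bochner integral of a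
  non-integrable function is 0, so that \<open>L2_norm\<close> is meaningful only on \<open>L2\<close>.\<close>

definition L2_tendsto ::
    "('i \<Rightarrow> real \<Rightarrow> complex) \<Rightarrow> (real \<Rightarrow> complex) \<Rightarrow> 'i filter \<Rightarrow> bool" where
  "L2_tendsto u h F \<longleftrightarrow> h \<in> L2 \<and> (\<forall>\<^sub>F i in F. u i \<in> L2) \<and>
     ((\<lambda>i. L2_norm (\<lambda>t. u i t - h t)) \<longlongrightarrow> 0) F"

text \<open>Boundedness forces a functional to agree on almost everywhere equal functions, so
  \<open>L2_dual\<close> is the topological dual of \<open>L\<^sup>2(\<real>)\<close>.\<close>

definition L2_dual :: "((real \<Rightarrow> complex) \<Rightarrow> complex) set" where
  "L2_dual = {\<phi>.
     (\<forall>f\<in>L2. \<forall>h\<in>L2. \<phi> (\<lambda>t. f t + h t) = \<phi> f + \<phi> h) \<and>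
     (\<forall>c. \<forall>f\<in>L2. \<phi> (\<lambda>t. c * f t) = c * \<phi> f) \<and>
     (\<exists>C. \<forall>f\<in>L2. cmod (\<phi> f) \<le> C * L2_norm f)}"

definition L2_weak_tendsto ::
    "('i \<Rightarrow> real \<Rightarrow> complex) \<Rightarrow> (real \<Rightarrow> complex) \<Rightarrow> 'i filter \<Rightarrow> bool" where
  "L2_weak_tendsto u h F \<longleftrightarrow> h \<in> L2 \<and> (\<forall>\<^sub>F i in F. u i \<in> L2) \<and>
     (\<forall>\<phi>\<in>L2_dual. ((\<lambda>i. \<phi> (u i)) \<longlongrightarrow> \<phi> h) F)"

definition L2_opnorm :: "((real \<Rightarrow> complex) \<Rightarrow> real \<Rightarrow> complex) \<Rightarrow> ennreal" where
  "L2_opnorm T =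
     (SUP f\<in>{f \<in> L2. L2_norm f \<le> 1}. if T f \<in> L2 then ennreal (L2_norm (T f)) else \<infinity>)"

definition translate :: "real \<Rightarrow> (real \<Rightarrow> complex) \<Rightarrow> real \<Rightarrow> complex" where
  "translate c f x = f (x - c)"

definition modulate :: "real \<Rightarrow> (real \<Rightarrow> complex) \<Rightarrow> real \<Rightarrow> complex" where
  "modulate c f x = exp (2 * of_real pi * \<i> * of_real c * of_real x) * f x"

definition gabor :: "(real \<Rightarrow> complex) \<Rightarrow> real \<Rightarrow> real \<Rightarrow> int \<times> int \<Rightarrow> real \<Rightarrow> complex" where
  "gabor g a b = (\<lambda>(m, n). modulate (of_int m * b) (translate (of_int n * a) g))"

definition preframe :: "(real \<Rightarrow> complex) \<Rightarrow> real \<Rightarrow> real \<Rightarrow> bool" where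
  "preframe g a b \<longleftrightarrow> (\<exists>B. \<forall>f\<in>L2.
     (\<lambda>p. (cmod (L2_inner f (gabor g a b p)))\<^sup>2) summable_on UNIV \<and>
     (\<Sum>\<^sub>\<infinity>p. (cmod (L2_inner f (gabor g a b p)))\<^sup>2) \<le> B * (L2_norm f)\<^sup>2)"

text \<open>The frame operator is the unconditional norm limit of the finite partial sums. For a
  preframe function \<open>g\<close> and \<open>f\<close> in \<open>L2\<close> this limit exists, and the choice of its
  representative is immaterial.\<close>

definition frame_op ::
    "(real \<Rightarrow> complex) \<Rightarrow> real \<Rightarrow> real \<Rightarrow> (real \<Rightarrow> complex) \<Rightarrow> real \<Rightarrow> complex" where
  "frame_op g a b f =
     (SOME h. L2_tendsto (\<lambda>I t. \<Sum>p\<in>I. L2_inner f (gabor g a b p) * gabor g a b p t) h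
        (finite_subsets_at_top UNIV))"

text \<open>For \<open>g\<close> in \<open>L2\<close> and \<open>a > 0\<close> this series converges absolutely for almost every \<open>t\<close>.\<close>

definition walnut_coeff ::
    "(real \<Rightarrow> complex) \<Rightarrow> real \<Rightarrow> real \<Rightarrow> int \<Rightarrow> real \<Rightarrow> complex" where
  "walnut_coeff g a b k t =
     (\<Sum>\<^sub>\<infinity>n::int. g (t - of_int n * a) * cnj (g (t - of_int n * a - of_int k / b)))"

definition walnut_sum ::
    "(real \<Rightarrow> complex) \<Rightarrow> real \<Rightarrow> real \<Rightarrow> int \<Rightarrow> int \<Rightarrow> (real \<Rightarrow> complex) \<Rightarrow> real \<Rightarrow> complex" where
  "walnut_sum g a b K L f t =
     (\<Sum>k = -L..K. f (t - of_int k / b) * walnut_coeff g a b k t)"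

definition TFAE :: "bool list \<Rightarrow> bool" where
  "TFAE Ps \<longleftrightarrow> (\<forall>P\<in>set Ps. \<forall>Q\<in>set Ps. P \<longleftrightarrow> Q)"

end

theory Submission
  imports Defs
begin

text \<open>
  Everything rests on one observation about functions \<open>f\<close> that vanish outside a single interval
  of length \<open>1/b\<close>, a cell. The translates of \<open>f\<close> by different multiples of \<open>1/b\<close> live in different
  cells, so the Walnut series of \<open>f\<close> has at most one nonzero term at each point. If \<open>h\<close> lives in a
  cell as well, then \<open>\<langle>S f, h\<rangle>\<close> can be computed: for fixed \<open>n\<close> the numbers \<open>\<langle>f, E\<^bsub>mb\<^esub> T\<^bsub>na\<^esub> g\<rangle>\<close> are Fourier
  coefficients on the basic period, Parseval's identity sums over \<open>m\<close>
  (\<open>gabor_parseval\<close>), and dominated convergence sums over \<open>n\<close> (\<open>frame_image_inner_cell\<close>). The result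
  is \<open>1/b\<close> times the inner product of \<open>h\<close> with the one term of the Walnut series that lives in the
  cell of \<open>h\<close>. Hence that term is the restriction of \<open>b S f\<close> to a cell (\<open>walnut_term_cell\<close>), the
  partial sum \<open>S\<^bsub>K,L\<^esub> f\<close> is a truncation of \<open>b S f\<close> to an interval, and it converges to \<open>b S f\<close> in norm
  (\<open>walnut_tendsto_cell\<close>). The domination comes from the bound \<open>\<Sum>n. |g (t - na)|\<^sup>2 \<le> b B\<close> almost
  everywhere (\<open>gabor_square_sum_le\<close>), where \<open>B\<close> is a Bessel bound; it also makes every function
  \<open>G\<^sub>k\<close> bounded, so that each \<open>S\<^bsub>K,L\<^esub>\<close> is a bounded operator.

  Finite sums of functions living in cells are dense. If the operators \<open>S\<^bsub>K,L\<^esub>\<close> are uniformly bounded,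
  then \<open>S\<^bsub>K,L\<^esub> f\<close> tends to \<open>b S f\<close> in norm for every \<open>f\<close> (\<open>walnut_tendsto_of_bounded\<close>). This implies norm
  convergence, weak convergence and the two formulas for the quadratic form, which are termwise
  the same. Conversely, weak convergence says, and convergence of the quadratic form implies by
  polarization, that \<open>\<langle>S\<^bsub>K,L\<^esub> f, h\<rangle>\<close> converges for all \<open>f\<close> and \<open>h\<close>. As these numbers are the partial
  sums of a two-sided series, they are then bounded over all \<open>K\<close> and \<open>L\<close>, and two applications of
  the uniform boundedness principle bound the operator norms
  (\<open>walnut_bounded_of_inner_convergent\<close>).

  The tools from functional analysis are developed for functions rather than equivalence classes:
  completeness of \<open>L\<^sup>2\<close> (\<open>L2_complete_net\<close>), synthesis with Bessel families
  (\<open>bessel_synthesis_converges\<close>), Parseval's identity for Fourier series (\<open>fourier_parseval\<close>) and the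
  uniform boundedness principle (\<open>L2_uniform_boundedness\<close>). Parseval's identity follows from
  Bessel's inequality and the fact that a function whose Fourier coefficients vanish is zero.
\<close>

section \<open>The seminormed space of square integrable functions\<close>

lemma L2_measurable [measurable_dest]: "f \<in> L2 \<Longrightarrow> f \<in> borel_measurable borel"
  by (simp add: L2_def)

lemma L2_integrable_square: "f \<in> L2 \<Longrightarrow> integrable lborel (\<lambda>t. (cmod (f t))\<^sup>2)"
  by (simp add: L2_def)

lemma L2I:
  "f \<in> borel_measurable borel \<Longrightarrow> integrable lborel (\<lambda>t. (cmod (f t))\<^sup>2) \<Longrightarrow> f \<in> L2"
  by (simp add: L2_def)

lemma L2I_bound:
  assumes [measurable]: "f \<in> borel_measurable borel" and w: "integrable lborel w"
    and le: "AE t in lborel. (cmod (f t))\<^sup>2 \<le> w t"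
  shows "f \<in> L2"
proof (rule L2I)
  show "integrable lborel (\<lambda>t. (cmod (f t))\<^sup>2)"
    by (rule Bochner_Integration.integrable_bound[OF w]) (use le in \<open>auto intro: order_trans abs_ge_self\<close>)
qed fact

lemma L2_product_integrable:
  assumes f: "f \<in> L2" and h: "h \<in> L2"
  shows "integrable lborel (\<lambda>t. f t * h t)"
proof -
  note [measurable] = L2_measurable[OF f] L2_measurable[OF h]
  have "cmod (f t * h t) \<le> (cmod (f t))\<^sup>2 + (cmod (h t))\<^sup>2" for t
  proof -
    have "2 * (cmod (f t) * cmod (h t)) \<le> (cmod (f t))\<^sup>2 + (cmod (h t))\<^sup>2"
      using sum_squares_bound[of "cmod (f t)" "cmod (h t)"] by (simp add: mult.assoc)
    moreover have "0 \<le> cmod (f t) * cmod (h t)" by simp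
    ultimately show ?thesis unfolding norm_mult by linarith
  qed
  then show ?thesis
    by (intro Bochner_Integration.integrable_bound[OF Bochner_Integration.integrable_add
          [OF L2_integrable_square[OF f] L2_integrable_square[OF h]]]) auto
qed

lemma borel_measurable_cnj [measurable (raw)]:
  "f \<in> borel_measurable M \<Longrightarrow> (\<lambda>t. cnj (f t)) \<in> borel_measurable M"
  by (rule measurable_compose[OF _ borel_measurable_continuous_onI[OF continuous_on_cnj[OF continuous_on_id]]])

lemma L2_cnj: "f \<in> L2 \<Longrightarrow> (\<lambda>t. cnj (f t)) \<in> L2"
  by (auto intro!: L2I borel_measurable_cnj simp: L2_integrable_square L2_measurable)

lemma L2_inner_integrable:
  "f \<in> L2 \<Longrightarrow> h \<in> L2 \<Longrightarrow> integrable lborel (\<lambda>t. f t * cnj (h t))"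
  by (intro L2_product_integrable L2_cnj)

lemma L2_zero [simp]: "(\<lambda>t. 0) \<in> L2"
  by (auto intro: L2I)

lemma L2_add:
  assumes f: "f \<in> L2" and h: "h \<in> L2"
  shows "(\<lambda>t. f t + h t) \<in> L2"
proof (rule L2I_bound)
  note [measurable] = L2_measurable[OF f] L2_measurable[OF h]
  show "(\<lambda>t. f t + h t) \<in> borel_measurable borel" by measurable
  show "integrable lborel (\<lambda>t. 2 * (cmod (f t))\<^sup>2 + 2 * (cmod (h t))\<^sup>2)"
    using f h by (auto simp: L2_integrable_square)
  have "(cmod (f t + h t))\<^sup>2 \<le> 2 * (cmod (f t))\<^sup>2 + 2 * (cmod (h t))\<^sup>2" for t
  proof -
    have "(cmod (f t + h t))\<^sup>2 \<le> (cmod (f t) + cmod (h t))\<^sup>2"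
      by (intro power_mono norm_triangle_ineq) auto
    also have "\<dots> \<le> 2 * (cmod (f t))\<^sup>2 + 2 * (cmod (h t))\<^sup>2"
      using sum_squares_bound[of "cmod (f t)" "cmod (h t)"] by (simp add: power2_sum)
    finally show ?thesis .
  qed
  then show "AE t in lborel. (cmod (f t + h t))\<^sup>2 \<le> 2 * (cmod (f t))\<^sup>2 + 2 * (cmod (h t))\<^sup>2" by simp
qed

text \<open>Scalar multiples, truncations and the terms of the Walnut series are special cases.\<close>

lemma
  assumes f: "f \<in> L2" and m[measurable]: "m \<in> borel_measurable borel"
    and le: "AE t in lborel. cmod (m t) \<le> C"
  shows L2_mult_bounded: "(\<lambda>t. m t * f t) \<in> L2"
    and L2_norm_mult_bounded: "0 \<le> C \<Longrightarrow> L2_norm (\<lambda>t. m t * f t) \<le> C * L2_norm f"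
proof -
  note [measurable] = L2_measurable[OF f]
  have le': "AE t in lborel. (cmod (m t * f t))\<^sup>2 \<le> C\<^sup>2 * (cmod (f t))\<^sup>2"
    using le by eventually_elim (auto simp: norm_mult power_mult_distrib intro!: mult_right_mono power_mono)
  show *: "(\<lambda>t. m t * f t) \<in> L2"
    by (rule L2I_bound[OF _ _ le']) (use f in \<open>auto simp: L2_integrable_square\<close>)
  assume "0 \<le> C"
  have "(LINT t|lborel. (cmod (m t * f t))\<^sup>2) \<le> (LINT t|lborel. C\<^sup>2 * (cmod (f t))\<^sup>2)"
    by (intro integral_mono_AE L2_integrable_square * le') (use f in \<open>auto simp: L2_integrable_square\<close>)
  also have "\<dots> = C\<^sup>2 * (LINT t|lborel. (cmod (f t))\<^sup>2)" by simp
  finally have "L2_norm (\<lambda>t. m t * f t) \<le> sqrt (C\<^sup>2 * (LINT t|lborel. (cmod (f t))\<^sup>2))"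
    unfolding L2_norm_def by simp
  then show "L2_norm (\<lambda>t. m t * f t) \<le> C * L2_norm f"
    using \<open>0 \<le> C\<close> by (simp add: L2_norm_def real_sqrt_mult)
qed

lemma L2_cmult: "f \<in> L2 \<Longrightarrow> (\<lambda>t. c * f t) \<in> L2"
  by (rule L2_mult_bounded[where C="cmod c"]) auto

lemma L2_uminus: "f \<in> L2 \<Longrightarrow> (\<lambda>t. - f t) \<in> L2"
  using L2_cmult[of f "-1"] by simp

lemma L2_diff: "f \<in> L2 \<Longrightarrow> h \<in> L2 \<Longrightarrow> (\<lambda>t. f t - h t) \<in> L2"
  using L2_add[of f "\<lambda>t. - h t"] L2_uminus[of h] by simp

lemma L2_sum: "(\<And>i. i \<in> A \<Longrightarrow> u i \<in> L2) \<Longrightarrow> (\<lambda>t. \<Sum>i\<in>A. u i t) \<in> L2"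
  by (induction A rule: infinite_finite_induct) (auto intro: L2_add)

lemma L2_restrict: "f \<in> L2 \<Longrightarrow> A \<in> sets borel \<Longrightarrow> (\<lambda>t. indicator A t * f t) \<in> L2"
  by (rule L2_mult_bounded[where C=1]) (auto simp: indicator_def)

lemma L2_norm_nonneg [simp]: "0 \<le> L2_norm f"
  by (simp add: L2_norm_def)

lemma L2_norm_square: "(L2_norm f)\<^sup>2 = (LINT t|lborel. (cmod (f t))\<^sup>2)"
  by (simp add: L2_norm_def)

lemma L2_inner_self: "L2_inner f f = of_real ((L2_norm f)\<^sup>2)"
  unfolding L2_norm_square L2_inner_def
  by (simp add: complex_norm_square[symmetric] flip: integral_complex_of_real of_real_power)

lemma L2_norm_cmult: "L2_norm (\<lambda>t. c * f t) = cmod c * L2_norm f"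
  by (simp add: L2_norm_def norm_mult power_mult_distrib real_sqrt_mult)

lemma L2_norm_uminus: "L2_norm (\<lambda>t. - f t) = L2_norm f"
  by (simp add: L2_norm_def)

lemma L2_norm_diff_commute: "L2_norm (\<lambda>t. f t - h t) = L2_norm (\<lambda>t. h t - f t)"
  by (simp add: L2_norm_def norm_minus_commute)

lemma L2_inner_cnj: "L2_inner h f = cnj (L2_inner f h)"
  unfolding L2_inner_def by (subst Bochner_Integration.integral_cnj[symmetric]) (simp add: mult.commute)

lemma L2_inner_add_left:
  "f \<in> L2 \<Longrightarrow> h \<in> L2 \<Longrightarrow> u \<in> L2 \<Longrightarrow> L2_inner (\<lambda>t. f t + h t) u = L2_inner f u + L2_inner h u"
  unfolding L2_inner_def by (simp add: L2_inner_integrable distrib_right)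

lemma L2_inner_diff_left:
  "f \<in> L2 \<Longrightarrow> h \<in> L2 \<Longrightarrow> u \<in> L2 \<Longrightarrow> L2_inner (\<lambda>t. f t - h t) u = L2_inner f u - L2_inner h u"
  unfolding L2_inner_def by (simp add: L2_inner_integrable left_diff_distrib)

lemma L2_inner_cmult_left: "L2_inner (\<lambda>t. c * f t) u = c * L2_inner f u"
  unfolding L2_inner_def by (simp add: mult.assoc)

lemma L2_inner_sum_left:
  "(\<And>i. i \<in> A \<Longrightarrow> u i \<in> L2) \<Longrightarrow> h \<in> L2 \<Longrightarrow>
    L2_inner (\<lambda>t. \<Sum>i\<in>A. u i t) h = (\<Sum>i\<in>A. L2_inner (u i) h)"
  unfolding L2_inner_def sum_distrib_right by (intro Bochner_Integration.integral_sum L2_inner_integrable)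

lemma L2_inner_add_right:
  "f \<in> L2 \<Longrightarrow> h \<in> L2 \<Longrightarrow> u \<in> L2 \<Longrightarrow> L2_inner u (\<lambda>t. f t + h t) = L2_inner u f + L2_inner u h"
  using L2_inner_add_left[of f h u] by (simp add: L2_inner_cnj[of u])

lemma L2_inner_diff_right:
  "f \<in> L2 \<Longrightarrow> h \<in> L2 \<Longrightarrow> u \<in> L2 \<Longrightarrow> L2_inner u (\<lambda>t. f t - h t) = L2_inner u f - L2_inner u h"
  using L2_inner_diff_left[of f h u] by (simp add: L2_inner_cnj[of u])

lemma L2_inner_cmult_right: "L2_inner u (\<lambda>t. c * f t) = cnj c * L2_inner u f"
  using L2_inner_cmult_left[of c f u] by (simp add: L2_inner_cnj[of u])

lemma L2_inner_sum_right:
  "(\<And>i. i \<in> A \<Longrightarrow> u i \<in> L2) \<Longrightarrow> h \<in> L2 \<Longrightarrow>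
    L2_inner h (\<lambda>t. \<Sum>i\<in>A. u i t) = (\<Sum>i\<in>A. L2_inner h (u i))"
  using L2_inner_sum_left[of A u h] by (simp add: L2_inner_cnj[of h])

lemma L2_norm_cong_AE:
  assumes [measurable]: "f \<in> borel_measurable borel" "h \<in> borel_measurable borel"
    and eq: "AE t in lborel. f t = h t"
  shows "L2_norm f = L2_norm h"
  unfolding L2_norm_def using eq by (auto intro!: integral_cong_AE arg_cong[where f=sqrt])

lemma L2_inner_cong_AE:
  assumes [measurable]: "f \<in> borel_measurable borel" "f' \<in> borel_measurable borel"
     "h \<in> borel_measurable borel" "h' \<in> borel_measurable borel"
    and eq: "AE t in lborel. f t * cnj (h t) = f' t * cnj (h' t)"
  shows "L2_inner f h = L2_inner f' h'"
  unfolding L2_inner_def by (rule integral_cong_AE) (use eq in simp_all)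

lemma L2_norm_zero_AE:
  assumes "f \<in> L2" "L2_norm f = 0"
  shows "AE t in lborel. f t = 0"
proof -
  have "(LINT t|lborel. (cmod (f t))\<^sup>2) = 0"
    using assms(2) by (simp add: L2_norm_def)
  then show ?thesis
    using integral_nonneg_eq_0_iff_AE[OF L2_integrable_square[OF assms(1)]] by simp
qed

lemma L2_Cauchy_Schwarz:
  assumes f: "f \<in> L2" and h: "h \<in> L2"
  shows "cmod (L2_inner f h) \<le> L2_norm f * L2_norm h"
proof (cases "L2_norm h = 0")
  case True
  note [measurable] = L2_measurable[OF f] L2_measurable[OF h]
  have "L2_inner f h = L2_inner f (\<lambda>t. 0)"
    by (rule L2_inner_cong_AE) (use L2_norm_zero_AE[OF h True] in auto)
  then show ?thesis by (simp add: L2_inner_def)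
next
  case False
  \<comment> \<open>\<open>c h\<close> is the orthogonal projection of \<open>f\<close> to the line of \<open>h\<close>.\<close>
  define c where "c = L2_inner f h / of_real ((L2_norm h)\<^sup>2)"
  have ch: "(\<lambda>t. c * h t) \<in> L2" by (rule L2_cmult[OF h])
  have c: "c * of_real ((L2_norm h)\<^sup>2) = L2_inner f h"
    using False by (simp add: c_def)
  have "L2_inner (\<lambda>t. f t - c * h t) (\<lambda>t. f t - c * h t)
      = L2_inner (\<lambda>t. f t - c * h t) f - cnj c * L2_inner (\<lambda>t. f t - c * h t) h"
    by (subst L2_inner_diff_right) (simp_all add: f h L2_diff L2_inner_cmult_right ch)
  also have "L2_inner (\<lambda>t. f t - c * h t) h = 0"
    using c by (simp add: L2_inner_diff_left f h ch L2_inner_cmult_left L2_inner_self)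
  also have "L2_inner (\<lambda>t. f t - c * h t) f = L2_inner f f - c * cnj (L2_inner f h)"
    by (simp add: L2_inner_diff_left f h ch L2_inner_cmult_left L2_inner_cnj[of h])
  also have "c * cnj (L2_inner f h) = of_real ((cmod (L2_inner f h))\<^sup>2 / (L2_norm h)\<^sup>2)"
    by (simp add: c_def complex_norm_square[symmetric])
  finally have "complex_of_real ((L2_norm (\<lambda>t. f t - c * h t))\<^sup>2)
      = of_real ((L2_norm f)\<^sup>2 - (cmod (L2_inner f h))\<^sup>2 / (L2_norm h)\<^sup>2)"
    by (simp add: L2_inner_self)
  then have "(L2_norm (\<lambda>t. f t - c * h t))\<^sup>2 = (L2_norm f)\<^sup>2 - (cmod (L2_inner f h))\<^sup>2 / (L2_norm h)\<^sup>2"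
    using of_real_eq_iff by blast
  then have "(cmod (L2_inner f h))\<^sup>2 / (L2_norm h)\<^sup>2 \<le> (L2_norm f)\<^sup>2"
    by (metis diff_ge_0_iff_ge zero_le_power2)
  then have "(cmod (L2_inner f h))\<^sup>2 \<le> (L2_norm f * L2_norm h)\<^sup>2"
    using False by (simp add: divide_simps power_mult_distrib split: if_splits)
  then show ?thesis by (rule power2_le_imp_le) simp
qed

lemma L2_norm_triangle:
  assumes f: "f \<in> L2" and h: "h \<in> L2"
  shows "L2_norm (\<lambda>t. f t + h t) \<le> L2_norm f + L2_norm h"
proof (rule power2_le_imp_le)
  have "complex_of_real ((L2_norm (\<lambda>t. f t + h t))\<^sup>2)
     = of_real ((L2_norm f)\<^sup>2 + (L2_norm h)\<^sup>2) + (L2_inner f h + cnj (L2_inner f h))"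
    unfolding L2_inner_self[symmetric] of_real_add
    by (simp add: L2_inner_add_left L2_inner_add_right L2_add f h L2_inner_cnj[of h f])
  also have "\<dots> = of_real ((L2_norm f)\<^sup>2 + (L2_norm h)\<^sup>2 + 2 * Re (L2_inner f h))"
    by (subst complex_add_cnj) simp
  finally have "(L2_norm (\<lambda>t. f t + h t))\<^sup>2 = (L2_norm f)\<^sup>2 + (L2_norm h)\<^sup>2 + 2 * Re (L2_inner f h)"
    using of_real_eq_iff by blast
  also have "\<dots> \<le> (L2_norm f)\<^sup>2 + (L2_norm h)\<^sup>2 + 2 * (L2_norm f * L2_norm h)"
    using complex_Re_le_cmod[of "L2_inner f h"] L2_Cauchy_Schwarz[OF f h] by linarith
  finally show "(L2_norm (\<lambda>t. f t + h t))\<^sup>2 \<le> (L2_norm f + L2_norm h)\<^sup>2"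
    by (simp add: power2_sum mult.assoc)
qed simp

lemma L2_norm_triangle_diff:
  assumes "f \<in> L2" "h \<in> L2" "u \<in> L2"
  shows "L2_norm (\<lambda>t. f t - u t) \<le> L2_norm (\<lambda>t. f t - h t) + L2_norm (\<lambda>t. h t - u t)"
  using L2_norm_triangle[OF L2_diff[OF assms(1,2)] L2_diff[OF assms(2,3)]] by simp

lemma L2_norm_sum_le:
  "(\<And>i. i \<in> A \<Longrightarrow> u i \<in> L2) \<Longrightarrow> L2_norm (\<lambda>t. \<Sum>i\<in>A. u i t) \<le> (\<Sum>i\<in>A. L2_norm (u i))"
proof (induction A rule: infinite_finite_induct)
  case (insert x F)
  then show ?case
    using L2_norm_triangle[of "u x" "\<lambda>t. \<Sum>i\<in>F. u i t"] L2_sum[of F u] by auto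
qed (simp_all add: L2_norm_def)

text \<open>Duality: test against \<open>f\<close> itself.\<close>

lemma L2_norm_le_of_inner:
  assumes "f \<in> L2" and "\<And>u. u \<in> L2 \<Longrightarrow> cmod (L2_inner f u) \<le> C * L2_norm u" "0 \<le> C"
  shows "L2_norm f \<le> C"
proof (cases "L2_norm f = 0")
  case False
  have "L2_norm f * L2_norm f \<le> C * L2_norm f"
    using assms(2)[OF assms(1)] by (simp add: L2_inner_self power2_eq_square norm_mult)
  then show ?thesis using False by (metis L2_norm_nonneg less_eq_real_def mult_right_le_imp_le)
qed (use assms in simp)

lemma L2_tendsto_inner:
  assumes "L2_tendsto u h F" "v \<in> L2"
  shows "((\<lambda>i. L2_inner (u i) v) \<longlongrightarrow> L2_inner h v) F"
proof -
  have h: "h \<in> L2" and u: "\<forall>\<^sub>F i in F. u i \<in> L2" and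
    lim: "((\<lambda>i. L2_norm (\<lambda>t. u i t - h t)) \<longlongrightarrow> 0) F"
    using assms(1) by (auto simp: L2_tendsto_def)
  have "((\<lambda>i. L2_norm (\<lambda>t. u i t - h t) * L2_norm v) \<longlongrightarrow> 0) F"
    using tendsto_mult_right[OF lim, of "L2_norm v"] by simp
  moreover have "\<forall>\<^sub>F i in F. norm (L2_inner (u i) v - L2_inner h v) \<le> L2_norm (\<lambda>t. u i t - h t) * L2_norm v"
    using u
  proof eventually_elim
    case (elim i)
    then show ?case
      using L2_Cauchy_Schwarz[OF L2_diff[OF elim h] assms(2)] by (simp add: L2_inner_diff_left h assms)
  qed
  ultimately show ?thesis
    by (subst LIM_zero_iff[symmetric]) (rule Lim_null_comparison)
qed

section \<open>Completeness\<close>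

lemma nn_integral_L2:
  assumes "f \<in> L2"
  shows "(\<integral>\<^sup>+t. ennreal ((cmod (f t))\<^sup>2) \<partial>lborel) = ennreal ((L2_norm f)\<^sup>2)"
  unfolding L2_norm_square by (rule nn_integral_eq_integral[OF L2_integrable_square[OF assms]]) simp

lemma
  assumes f [measurable]: "f \<in> borel_measurable borel" and "0 \<le> C"
    and le: "(\<integral>\<^sup>+t. ennreal ((cmod (f t))\<^sup>2) \<partial>lborel) \<le> ennreal (C\<^sup>2)"
  shows L2I_nn_integral: "f \<in> L2" and L2_norm_le_nn_integral: "L2_norm f \<le> C"
proof -
  show *: "f \<in> L2"
    by (intro L2I f integrableI_bounded) (use le in \<open>auto simp: top_unique intro: le_less_trans\<close>)
  show "L2_norm f \<le> C"
    using le by (intro power2_le_imp_le[OF _ \<open>0 \<le> C\<close>]) (simp add: nn_integral_L2[OF *])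
qed

lemma
  assumes v: "\<And>n. v n \<in> L2" and h[measurable]: "h \<in> borel_measurable borel" and "0 \<le> C"
    and le: "\<And>n. N \<le> n \<Longrightarrow> L2_norm (v n) \<le> C"
    and lim: "AE t in lborel. (\<lambda>n::nat. v n t) \<longlonglongrightarrow> h t"
  shows L2_Fatou: "h \<in> L2" and L2_norm_Fatou: "L2_norm h \<le> C"
proof -
  note [measurable] = L2_measurable[OF v]
  have "(\<integral>\<^sup>+t. ennreal ((cmod (h t))\<^sup>2) \<partial>lborel)
      = (\<integral>\<^sup>+t. liminf (\<lambda>n. ennreal ((cmod (v n t))\<^sup>2)) \<partial>lborel)"
  proof (rule nn_integral_cong_AE)
    show "AE t in lborel. ennreal ((cmod (h t))\<^sup>2) = liminf (\<lambda>n. ennreal ((cmod (v n t))\<^sup>2))"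
      using lim
    proof eventually_elim
      case (elim t)
      have "(\<lambda>n. ennreal ((cmod (v n t))\<^sup>2)) \<longlonglongrightarrow> ennreal ((cmod (h t))\<^sup>2)"
        by (intro tendsto_intros elim) 
      from lim_imp_Liminf[OF _ this] show ?case by simp
    qed
  qed
  also have "\<dots> \<le> liminf (\<lambda>n. \<integral>\<^sup>+t. ennreal ((cmod (v n t))\<^sup>2) \<partial>lborel)"
    by (rule nn_integral_liminf) measurable
  also have "\<dots> \<le> ennreal (C\<^sup>2)"
  proof (rule Liminf_le)
    show "\<forall>\<^sub>F n in sequentially. (\<integral>\<^sup>+t. ennreal ((cmod (v n t))\<^sup>2) \<partial>lborel) \<le> ennreal (C\<^sup>2)"
      using eventually_ge_at_top[of N]
      by eventually_elim (auto simp: nn_integral_L2[OF v] intro!: ennreal_leI power_mono le)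
  qed simp
  finally have *: "(\<integral>\<^sup>+t. ennreal ((cmod (h t))\<^sup>2) \<partial>lborel) \<le> ennreal (C\<^sup>2)" .
  show "h \<in> L2" "L2_norm h \<le> C"
    using L2I_nn_integral[OF h \<open>0 \<le> C\<close> *] L2_norm_le_nn_integral[OF h \<open>0 \<le> C\<close> *] by auto
qed

lemma L2_norm_telescope:
  assumes u: "\<And>n. u n \<in> L2" and step: "\<And>n. L2_norm (\<lambda>t. u (Suc n) t - u n t) \<le> d n"
    and "m \<le> n"
  shows "L2_norm (\<lambda>t. u n t - u m t) \<le> (\<Sum>k=m..<n. d k)"
  using \<open>m \<le> n\<close>
proof (induction n rule: dec_induct)
  case (step n)
  then show ?case
    using L2_norm_triangle_diff[OF u u u, of "Suc n" m n] assms(2)[of n] by simp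
qed (simp add: L2_norm_def)

lemma sum_power_le_tail:
  fixes c :: real
  assumes "0 \<le> c" "c < 1"
  shows "(\<Sum>k=m..<n. c ^ k) \<le> c ^ m / (1 - c)"
proof (cases "m \<le> n")
  case True
  then have "(1 - c) * (\<Sum>k=m..<n. c ^ k) = c ^ m - c ^ n"
  proof (induction n rule: dec_induct)
    case (step n)
    have "(1 - c) * (\<Sum>k=m..<Suc n. c ^ k) = (1 - c) * (\<Sum>k=m..<n. c ^ k) + (1 - c) * c ^ n"
      using step by (simp add: distrib_left)
    also have "\<dots> = c ^ m - c ^ Suc n"
      unfolding step.IH by (simp add: left_diff_distrib)
    finally show ?case .
  qed simp
  also have "\<dots> \<le> c ^ m" using assms by simp
  finally show ?thesis using assms by (simp add: field_simps)
qed (use assms in simp)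

text \<open>The variation \<open>\<Sum>\<bar>u (n+1) - u n\<bar>\<close> has finite norm by monotone convergence. Hence it is
  finite almost everywhere, which gives a pointwise limit; Fatou's lemma turns the Cauchy
  estimate into an estimate of the distance to this limit.\<close>

lemma L2_complete_fast:
  fixes c :: real
  assumes u: "\<And>n. u n \<in> L2" and c: "0 \<le> c" "c < 1"
    and step: "\<And>n. L2_norm (\<lambda>t. u (Suc n) t - u n t) \<le> c ^ n"
  obtains h where "h \<in> L2" "\<And>n. L2_norm (\<lambda>t. u n t - h t) \<le> c ^ n / (1 - c)"
proof -
  note [measurable] = L2_measurable[OF u]
  define A where "A N t = (\<Sum>n<N. cmod (u (Suc n) t - u n t))" for N :: nat and t
  have A0: "0 \<le> A N t" for N t by (simp add: A_def sum_nonneg)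
  have Ameas [measurable]: "A N \<in> borel_measurable borel" for N unfolding A_def by measurable
  have absL2: "(\<lambda>t. complex_of_real (cmod (u (Suc n) t - u n t))) \<in> L2"
    and abs_norm: "L2_norm (\<lambda>t. complex_of_real (cmod (u (Suc n) t - u n t))) \<le> c ^ n" for n
    using L2_diff[OF u u, of "Suc n" n] step[of n] by (auto simp: L2_def L2_norm_def)
  have AL2: "(\<lambda>t. complex_of_real (A N t)) \<in> L2" for N
    unfolding A_def of_real_sum by (intro L2_sum absL2)
  have "L2_norm (\<lambda>t. complex_of_real (A N t)) \<le> 1 / (1 - c)" for N
  proof -
    have "L2_norm (\<lambda>t. complex_of_real (A N t)) \<le> (\<Sum>n<N. c ^ n)"
      unfolding A_def of_real_sum by (rule order_trans[OF L2_norm_sum_le[OF absL2] sum_mono[OF abs_norm]])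
    also have "\<dots> \<le> 1 / (1 - c)"
      using sum_power_le_tail[OF c, of 0 N] by (simp add: lessThan_atLeast0)
    finally show ?thesis .
  qed
  then have "(\<integral>\<^sup>+t. ennreal ((A N t)\<^sup>2) \<partial>lborel) \<le> ennreal ((1 / (1 - c))\<^sup>2)" for N
    using nn_integral_L2[OF AL2, of N] by (simp add: ennreal_leI power_mono A0)
  then have "(SUP N. \<integral>\<^sup>+t. ennreal ((A N t)\<^sup>2) \<partial>lborel) \<le> ennreal ((1 / (1 - c))\<^sup>2)"
    by (intro SUP_least)
  moreover have "incseq (\<lambda>N t. ennreal ((A N t)\<^sup>2))"
    by (auto simp: incseq_def le_fun_def A_def intro!: ennreal_leI power_mono sum_mono2 sum_nonneg)
  ultimately have "(\<integral>\<^sup>+t. (SUP N. ennreal ((A N t)\<^sup>2)) \<partial>lborel) \<le> ennreal ((1 / (1 - c))\<^sup>2)"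
    by (subst nn_integral_monotone_convergence_SUP) simp_all
  then have "(\<integral>\<^sup>+t. (SUP N. ennreal ((A N t)\<^sup>2)) \<partial>lborel) \<noteq> \<infinity>"
    by (auto simp: top_unique)
  then have "AE t in lborel. (SUP N. ennreal ((A N t)\<^sup>2)) \<noteq> \<infinity>"
    by (intro nn_integral_PInf_AE) auto
  then have conv: "AE t in lborel. convergent (\<lambda>n. u n t)"
  proof eventually_elim
    case (elim t)
    then obtain M where M: "(SUP N. ennreal ((A N t)\<^sup>2)) = ennreal M" "0 \<le> M"
      by (cases "SUP N. ennreal ((A N t)\<^sup>2)") auto
    have "(A N t)\<^sup>2 \<le> M" for N
    proof -
      have "ennreal ((A N t)\<^sup>2) \<le> ennreal M"
        unfolding M(1)[symmetric] by (intro SUP_upper) simp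
      then show ?thesis using M(2) by simp
    qed
    then have "A N t \<le> sqrt M" for N using real_le_rsqrt by blast
    then have "summable (\<lambda>n. cmod (u (Suc n) t - u n t))"
      by (intro summableI_nonneg_bounded[of _ "sqrt M"]) (auto simp: A_def)
    then have "summable (\<lambda>n. u (Suc n) t - u n t)" by (rule summable_norm_cancel)
    then have "convergent (\<lambda>N. \<Sum>n<N. u (Suc n) t - u n t)" by (simp add: summable_iff_convergent)
    then have "convergent (\<lambda>N. u N t - u 0 t)" by (simp only: sum_lessThan_telescope[of "\<lambda>n. u n t"])
    then show ?case by (simp add: convergent_diff_const_right_iff)
  qed
  define h where "h t = lim (\<lambda>n. u n t)" for t
  have h [measurable]: "h \<in> borel_measurable borel" unfolding h_def by measurable
  have lim: "AE t in lborel. (\<lambda>n. u n t) \<longlonglongrightarrow> h t"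
    using conv by eventually_elim (simp add: h_def convergent_LIMSEQ_iff)
  have *: "(\<lambda>t. h t - u n t) \<in> L2" "L2_norm (\<lambda>t. h t - u n t) \<le> c ^ n / (1 - c)" for n
  proof -
    have le: "L2_norm (\<lambda>t. u m t - u n t) \<le> c ^ n / (1 - c)" if "n \<le> m" for m
      using L2_norm_telescope[of u, OF u step that] sum_power_le_tail[OF c, of n m] by simp
    have lim': "AE t in lborel. (\<lambda>m. u m t - u n t) \<longlonglongrightarrow> h t - u n t"
      using lim by eventually_elim (auto intro: tendsto_intros)
    have C: "0 \<le> c ^ n / (1 - c)" using c by simp
    show "(\<lambda>t. h t - u n t) \<in> L2" "L2_norm (\<lambda>t. h t - u n t) \<le> c ^ n / (1 - c)"
      using L2_Fatou[OF L2_diff[OF u u] _ C le lim'] L2_norm_Fatou[OF L2_diff[OF u u] _ C le lim'] by auto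
  qed
  have "h \<in> L2" using L2_add[OF *(1)[of 0] u[of 0]] by simp
  with *(2) show ?thesis by (intro that[of h]) (auto simp: L2_norm_diff_commute[of _ h])
qed

text \<open>A Cauchy net has a rapidly converging sequence of members with the same limit. Both the
  double limits in \<open>K\<close> and \<open>L\<close> and the unordered sums of the frame operator are nets.\<close>

lemma L2_complete_net:
  assumes F: "F \<noteq> bot"
    and Cauchy: "\<And>\<epsilon>. 0 < \<epsilon> \<Longrightarrow> \<exists>P. eventually P F \<and>
      (\<forall>i j. P i \<longrightarrow> P j \<longrightarrow> u i \<in> L2 \<and> L2_norm (\<lambda>t. u i t - u j t) \<le> \<epsilon>)"
  obtains h where "L2_tendsto u h F"
proof -
  have "\<exists>P. eventually P F \<and> (\<forall>i j. P i \<longrightarrow> P j \<longrightarrow> u i \<in> L2 \<and> L2_norm (\<lambda>t. u i t - u j t) \<le> (1/2) ^ n)"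
    for n :: nat
    by (rule Cauchy) simp
  then obtain P where P: "\<And>n. eventually (P n) F"
    "\<And>n i j. P n i \<Longrightarrow> P n j \<Longrightarrow> u i \<in> L2 \<and> L2_norm (\<lambda>t. u i t - u j t) \<le> (1/2) ^ (n::nat)"
    by metis
  have "\<exists>i. \<forall>k\<le>n. P k i" for n
  proof -
    have "eventually (\<lambda>i. \<forall>k\<in>{..n}. P k i) F" by (intro eventually_ball_finite) (auto intro: P)
    from eventually_happens'[OF F this] show ?thesis by auto
  qed
  then obtain s where s: "\<And>n k. k \<le> n \<Longrightarrow> P k (s n)" by metis
  have us: "u (s n) \<in> L2" for n using P(2)[OF s s] by blast
  have "L2_norm (\<lambda>t. u (s (Suc n)) t - u (s n) t) \<le> (1/2) ^ n" for n
    using P(2)[of n "s (Suc n)" "s n"] s by simp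
  from L2_complete_fast[of "\<lambda>n. u (s n)", OF us _ _ this]
  obtain h where h: "h \<in> L2" "\<And>n. L2_norm (\<lambda>t. u (s n) t - h t) \<le> (1/2) ^ n / (1 - 1/2)" by auto
  have close: "L2_norm (\<lambda>t. u i t - h t) \<le> 3 * (1/2) ^ n" if "P n i" for n i
    using L2_norm_triangle_diff[of "u i" "u (s n)" h] P(2)[OF that s, of n] h(1) h(2)[of n] us[of n] by simp
  have "((\<lambda>i. L2_norm (\<lambda>t. u i t - h t)) \<longlongrightarrow> 0) F"
  proof (rule tendstoI)
    fix e :: real assume "e > 0"
    then obtain n where n: "(1/2) ^ n < e / 3"
      using real_arch_pow_inv[of "e/3" "1/2"] by auto
    show "\<forall>\<^sub>F i in F. dist (L2_norm (\<lambda>t. u i t - h t)) 0 < e"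
      using P(1)[of n]
    proof eventually_elim
      case (elim i)
      show ?case using close[OF elim] n by (simp add: dist_real_def)
    qed
  qed
  moreover have "\<forall>\<^sub>F i in F. u i \<in> L2"
    using P(1)[of 0] by eventually_elim (use P(2) in blast)
  ultimately show ?thesis using h(1) that by (auto simp: L2_tendsto_def)
qed

section \<open>Bessel families\<close>

definition bessel :: "('p \<Rightarrow> real \<Rightarrow> complex) \<Rightarrow> real \<Rightarrow> bool" where
  "bessel e B \<longleftrightarrow> 0 \<le> B \<and> (\<forall>p. e p \<in> L2) \<and>
     (\<forall>f\<in>L2. \<forall>A. finite A \<longrightarrow> (\<Sum>p\<in>A. (cmod (L2_inner f (e p)))\<^sup>2) \<le> B * (L2_norm f)\<^sup>2)"

text \<open>\<open>frame_image e f h\<close> says weakly that \<open>h = \<Sum>p. \<langle>f, e p\<rangle> e p\<close>, that is, that \<open>h\<close> represents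
  the image of \<open>f\<close> under the frame operator of \<open>e\<close>. As a relation it is insensitive to the choice
  of representatives, and its linearity is linearity of the inner product.\<close>

definition frame_image ::
    "('p \<Rightarrow> real \<Rightarrow> complex) \<Rightarrow> (real \<Rightarrow> complex) \<Rightarrow> (real \<Rightarrow> complex) \<Rightarrow> bool" where
  "frame_image e f h \<longleftrightarrow> h \<in> L2 \<and>
     (\<forall>u\<in>L2. ((\<lambda>p. L2_inner f (e p) * cnj (L2_inner u (e p))) has_sum L2_inner h u) UNIV)"

lemma Cauchy_Schwarz_sum_cmod:
  fixes x y :: "'a \<Rightarrow> complex"
  shows "(\<Sum>p\<in>A. cmod (x p * cnj (y p))) \<le> sqrt (\<Sum>p\<in>A. (cmod (x p))\<^sup>2) * sqrt (\<Sum>p\<in>A. (cmod (y p))\<^sup>2)"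
  unfolding norm_mult complex_mod_cnj real_sqrt_mult[symmetric]
  by (rule real_le_rsqrt) (rule Cauchy_Schwarz_ineq_sum)

lemma bessel_L2: "bessel e B \<Longrightarrow> e p \<in> L2"
  by (simp add: bessel_def)

lemma bessel_sum_le:
  "bessel e B \<Longrightarrow> f \<in> L2 \<Longrightarrow> finite A \<Longrightarrow> (\<Sum>p\<in>A. (cmod (L2_inner f (e p)))\<^sup>2) \<le> B * (L2_norm f)\<^sup>2"
  by (simp add: bessel_def)

lemma bessel_summable:
  assumes "bessel e B" "f \<in> L2"
  shows "(\<lambda>p. (cmod (L2_inner f (e p)))\<^sup>2) summable_on UNIV"
  by (rule nonneg_bounded_partial_sums_imp_summable_on[where C="B * (L2_norm f)\<^sup>2"])
     (auto intro!: eventually_finite_subsets_at_top_weakI bessel_sum_le assms)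

lemma bessel_product_sum_le:
  assumes e: "bessel e B" and fu: "f \<in> L2" "u \<in> L2" and "finite A"
  shows "(\<Sum>p\<in>A. cmod (L2_inner f (e p) * cnj (L2_inner u (e p)))) \<le> B * L2_norm f * L2_norm u"
proof -
  have "(\<Sum>p\<in>A. cmod (L2_inner f (e p) * cnj (L2_inner u (e p))))
      \<le> sqrt (B * (L2_norm f)\<^sup>2) * sqrt (B * (L2_norm u)\<^sup>2)"
    by (rule order_trans[OF Cauchy_Schwarz_sum_cmod])
       (intro mult_mono real_sqrt_le_mono bessel_sum_le e fu \<open>finite A\<close>, auto simp: sum_nonneg e[unfolded bessel_def])
  also have "\<dots> = B * L2_norm f * L2_norm u"
    using e by (simp add: real_sqrt_mult bessel_def)
  finally show ?thesis .
qed

lemma frame_image_norm_le: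
  assumes e: "bessel e B" and f: "f \<in> L2" and h: "frame_image e f h"
  shows "L2_norm h \<le> B * L2_norm f"
proof (rule L2_norm_le_of_inner)
  fix u assume u: "u \<in> L2"
  have "((\<lambda>p. L2_inner f (e p) * cnj (L2_inner u (e p))) has_sum L2_inner h u) UNIV"
    using h u by (simp add: frame_image_def)
  then have "((\<lambda>A. \<Sum>p\<in>A. L2_inner f (e p) * cnj (L2_inner u (e p))) \<longlongrightarrow> L2_inner h u)
      (finite_subsets_at_top UNIV)" by (simp add: has_sum_def)
  then have "((\<lambda>A. cmod (\<Sum>p\<in>A. L2_inner f (e p) * cnj (L2_inner u (e p)))) \<longlongrightarrow> cmod (L2_inner h u))
      (finite_subsets_at_top UNIV)" by (rule tendsto_norm)
  then show "cmod (L2_inner h u) \<le> B * L2_norm f * L2_norm u"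
    by (rule tendsto_upperbound)
       (auto intro!: eventually_finite_subsets_at_top_weakI order_trans[OF norm_sum bessel_product_sum_le[OF e f u]])
qed (use e h in \<open>auto simp: bessel_def frame_image_def\<close>)

lemma frame_image_add:
  assumes e: "bessel e B" and "f \<in> L2" "f' \<in> L2" "frame_image e f h" "frame_image e f' h'"
  shows "frame_image e (\<lambda>t. f t + f' t) (\<lambda>t. h t + h' t)"
  unfolding frame_image_def
proof (intro conjI ballI)
  show "(\<lambda>t. h t + h' t) \<in> L2" using assms by (simp add: frame_image_def L2_add)
  fix u assume u: "u \<in> L2"
  have "((\<lambda>p. L2_inner f (e p) * cnj (L2_inner u (e p)) + L2_inner f' (e p) * cnj (L2_inner u (e p)))
      has_sum (L2_inner h u + L2_inner h' u)) UNIV"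
    using assms u by (intro has_sum_add) (auto simp: frame_image_def)
  then show "((\<lambda>p. L2_inner (\<lambda>t. f t + f' t) (e p) * cnj (L2_inner u (e p))) has_sum
      L2_inner (\<lambda>t. h t + h' t) u) UNIV"
    using assms u by (simp add: frame_image_def L2_inner_add_left bessel_L2[OF e] distrib_right)
qed

lemma frame_image_cmult:
  assumes "frame_image e f h"
  shows "frame_image e (\<lambda>t. c * f t) (\<lambda>t. c * h t)"
  using assms
  by (auto simp: frame_image_def L2_cmult L2_inner_cmult_left mult.assoc intro: has_sum_cmult_right)

lemma frame_image_diff:
  assumes "bessel e B" "f \<in> L2" "f' \<in> L2" "frame_image e f h" "frame_image e f' h'"
  shows "frame_image e (\<lambda>t. f t - f' t) (\<lambda>t. h t - h' t)"
  using frame_image_add[OF assms(1,2) L2_uminus[OF assms(3)] assms(4), of "\<lambda>t. - h' t"]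
    frame_image_cmult[OF assms(5), of "-1"] by simp

text \<open>The norm of synthesis is at most that of analysis, its adjoint: pair the sum with itself and
  apply the Bessel inequality to it.\<close>

lemma bessel_synthesis_norm:
  assumes e: "bessel e B" and "finite A"
  shows "(L2_norm (\<lambda>t. \<Sum>p\<in>A. c p * e p t))\<^sup>2 \<le> B * (\<Sum>p\<in>A. (cmod (c p))\<^sup>2)"
proof -
  define s where "s t = (\<Sum>p\<in>A. c p * e p t)" for t
  have s: "s \<in> L2" unfolding s_def by (intro L2_sum L2_cmult bessel_L2[OF e])
  have ss: "L2_inner s s = (\<Sum>p\<in>A. c p * cnj (L2_inner s (e p)))"
  proof -
    have "L2_inner s s = L2_inner (\<lambda>t. \<Sum>p\<in>A. c p * e p t) s" by (simp add: s_def[abs_def])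
    also have "\<dots> = (\<Sum>p\<in>A. c p * L2_inner (e p) s)"
      by (simp add: L2_inner_sum_left L2_cmult bessel_L2[OF e] s L2_inner_cmult_left)
    finally show ?thesis unfolding L2_inner_cnj[of "e _" s] .
  qed
  then have "(L2_norm s)\<^sup>2 = cmod (\<Sum>p\<in>A. c p * cnj (L2_inner s (e p)))"
    by (simp add: L2_inner_self norm_power flip: ss)
  also have "\<dots> \<le> sqrt (\<Sum>p\<in>A. (cmod (c p))\<^sup>2) * sqrt (\<Sum>p\<in>A. (cmod (L2_inner s (e p)))\<^sup>2)"
    by (rule order_trans[OF norm_sum Cauchy_Schwarz_sum_cmod])
  also have "\<dots> \<le> sqrt (\<Sum>p\<in>A. (cmod (c p))\<^sup>2) * sqrt (B * (L2_norm s)\<^sup>2)"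
    by (intro mult_left_mono real_sqrt_le_mono bessel_sum_le e s assms) (simp add: sum_nonneg)
  also have "\<dots> = sqrt (B * (\<Sum>p\<in>A. (cmod (c p))\<^sup>2)) * L2_norm s"
    by (simp add: real_sqrt_mult)
  finally have "L2_norm s * L2_norm s \<le> sqrt (B * (\<Sum>p\<in>A. (cmod (c p))\<^sup>2)) * L2_norm s"
    by (simp add: power2_eq_square)
  moreover have B: "0 \<le> B * (\<Sum>p\<in>A. (cmod (c p))\<^sup>2)"
    using e by (simp add: bessel_def sum_nonneg)
  ultimately have "L2_norm s \<le> sqrt (B * (\<Sum>p\<in>A. (cmod (c p))\<^sup>2))"
    using L2_norm_nonneg[of s] by (cases "L2_norm s = 0") (auto simp: mult_le_cancel_right)
  then have "(L2_norm s)\<^sup>2 \<le> B * (\<Sum>p\<in>A. (cmod (c p))\<^sup>2)"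
    using power_mono[OF _ L2_norm_nonneg, of s _ 2] B by fastforce
  then show ?thesis by (simp add: s_def[abs_def])
qed

text \<open>By the preceding estimate the finite partial sums of \<open>\<Sum>p. \<langle>f, e p\<rangle> e p\<close> form a Cauchy net,
  because their coefficients are square summable.\<close>

lemma bessel_synthesis_converges:
  assumes e: "bessel e B" and f: "f \<in> L2"
  obtains h where "L2_tendsto (\<lambda>A t. \<Sum>p\<in>A. L2_inner f (e p) * e p t) h (finite_subsets_at_top UNIV)"
proof (rule L2_complete_net)
  let ?c = "\<lambda>p. (cmod (L2_inner f (e p)))\<^sup>2"
  let ?s = "\<lambda>A t. \<Sum>p\<in>A. L2_inner f (e p) * e p t"
  have sL2: "?s A \<in> L2" for A by (intro L2_sum L2_cmult bessel_L2[OF e])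
  have B: "0 \<le> B" using e by (simp add: bessel_def)
  fix \<epsilon> :: real assume \<epsilon>: "0 < \<epsilon>"
  define \<delta> where "\<delta> = (\<epsilon> / 2)\<^sup>2 / (B + 1)"
  have \<delta>: "0 < \<delta>" "B * \<delta> \<le> (\<epsilon> / 2)\<^sup>2" using \<epsilon> B by (auto simp: \<delta>_def field_simps)
  define S where "S = infsum ?c UNIV"
  have S: "(?c has_sum S) UNIV" unfolding S_def by (rule has_sum_infsum[OF bessel_summable[OF e f]])
  then have "\<forall>\<^sub>F A in finite_subsets_at_top UNIV. S - \<delta> < sum ?c A"
    unfolding has_sum_def by (rule order_tendstoD) (use \<delta> in simp)
  then obtain A0 where A0: "finite A0" "S - \<delta> < sum ?c A0"
    unfolding eventually_finite_subsets_at_top by blast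
  have tail: "L2_norm (\<lambda>t. ?s A t - ?s A0 t) \<le> \<epsilon> / 2" if A: "finite A" "A0 \<subseteq> A" for A
  proof -
    have "sum ?c A \<le> S"
      unfolding S_def by (rule finite_sum_le_infsum[OF bessel_summable[OF e f]]) (use A in auto)
    then have "sum ?c (A - A0) \<le> \<delta>" using A A0 by (simp add: sum_diff)
    then have "B * sum ?c (A - A0) \<le> (\<epsilon> / 2)\<^sup>2"
      using B \<delta> by (meson mult_left_mono order_trans)
    moreover have "(\<lambda>t. ?s A t - ?s A0 t) = ?s (A - A0)"
      using A A0 by (auto simp: sum_diff)
    ultimately have "(L2_norm (\<lambda>t. ?s A t - ?s A0 t))\<^sup>2 \<le> (\<epsilon> / 2)\<^sup>2"
      using bessel_synthesis_norm[OF e, of "A - A0" "\<lambda>p. L2_inner f (e p)"] A by simp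
    then show ?thesis by (rule power2_le_imp_le) (use \<epsilon> in simp)
  qed
  show "\<exists>P. eventually P (finite_subsets_at_top UNIV) \<and>
      (\<forall>I J. P I \<longrightarrow> P J \<longrightarrow> ?s I \<in> L2 \<and> L2_norm (\<lambda>t. ?s I t - ?s J t) \<le> \<epsilon>)"
  proof (intro exI conjI allI impI)
    show "\<forall>\<^sub>F A in finite_subsets_at_top UNIV. finite A \<and> A0 \<subseteq> A"
      using A0(1) by (auto simp: eventually_finite_subsets_at_top)
  next
    fix I J assume "finite I \<and> A0 \<subseteq> I" "finite J \<and> A0 \<subseteq> J"
    then show "L2_norm (\<lambda>t. ?s I t - ?s J t) \<le> \<epsilon>"
      using L2_norm_triangle_diff[OF sL2[of I] sL2[of A0] sL2[of J]] tail[of I] tail[of J]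
      by (simp add: L2_norm_diff_commute[of "?s A0"])
  qed (rule sL2)
qed (simp, rule that)

lemma frame_image_of_tendsto:
  assumes e: "bessel e B" and f: "f \<in> L2"
    and lim: "L2_tendsto (\<lambda>A t. \<Sum>p\<in>A. L2_inner f (e p) * e p t) h (finite_subsets_at_top UNIV)"
  shows "frame_image e f h"
proof -
  have "((\<lambda>p. L2_inner f (e p) * cnj (L2_inner u (e p))) has_sum L2_inner h u) UNIV" if u: "u \<in> L2" for u
    using L2_tendsto_inner[OF lim u] unfolding has_sum_def L2_inner_cnj[of "e _" u, symmetric]
    by (simp add: L2_inner_sum_left L2_cmult bessel_L2[OF e] u L2_inner_cmult_left)
  then show ?thesis using lim by (simp add: frame_image_def L2_tendsto_def)
qed

lemma frame_image_exists:
  assumes "bessel e B" "f \<in> L2"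
  obtains h where "frame_image e f h"
  using bessel_synthesis_converges[OF assms] frame_image_of_tendsto[OF assms] by metis

section \<open>Fourier series on an interval\<close>

lemma borel_measurable_cis [measurable]: "cis \<in> borel_measurable borel"
  by (intro borel_measurable_continuous_onI continuous_intros)

lemma integrable_mult_bounded:
  fixes D :: "real \<Rightarrow> complex"
  assumes D: "integrable lborel D" and [measurable]: "m \<in> borel_measurable borel"
    and "\<And>t. cmod (m t) \<le> C"
  shows "integrable lborel (\<lambda>t. D t * m t)"
proof (rule Bochner_Integration.integrable_bound)
  show "integrable lborel (\<lambda>t. of_real C * D t)" using D by simp
  have [measurable]: "D \<in> borel_measurable borel" using borel_measurable_integrable[OF D] by simp
  show "(\<lambda>t. D t * m t) \<in> borel_measurable lborel" by measurable
  show "AE t in lborel. norm (D t * m t) \<le> norm (complex_of_real C * D t)"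
  proof (intro AE_I2)
    fix t show "norm (D t * m t) \<le> norm (complex_of_real C * D t)"
      using mult_left_mono[OF order_trans[OF assms(3)[of t] abs_ge_self], of "cmod (D t)"]
      by (simp add: norm_mult mult.commute)
  qed
qed

text \<open>The point of considering all coefficients at once is that this class is stable under
  multiplication by exponentials, hence by real polynomials in \<open>(cos, sin)\<close>.\<close>

definition fourier_null :: "real \<Rightarrow> (real \<Rightarrow> complex) \<Rightarrow> bool" where
  "fourier_null b D \<longleftrightarrow> integrable lborel D \<and>
     (\<forall>m::int. (LINT t|lborel. D t * cis (2 * pi * (of_int m * b) * t)) = 0)"

lemma integrable_mult_cis:
  "integrable lborel D \<Longrightarrow> integrable lborel (\<lambda>t. D t * cis (c * t))"
  by (rule integrable_mult_bounded[where C=1]) auto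

lemma fourier_null_lin:
  assumes "fourier_null b D" "fourier_null b E"
  shows "fourier_null b (\<lambda>t. \<alpha> * D t + \<beta> * E t)"
  unfolding fourier_null_def
proof (intro conjI allI)
  show "integrable lborel (\<lambda>t. \<alpha> * D t + \<beta> * E t)" using assms by (simp add: fourier_null_def)
  fix m :: int
  let ?c = "\<lambda>t. cis (2 * pi * (of_int m * b) * t)"
  have "(LINT t|lborel. \<alpha> * (D t * ?c t) + \<beta> * (E t * ?c t)) = 0"
    using assms by (subst Bochner_Integration.integral_add) (auto simp: fourier_null_def integrable_mult_cis)
  then show "(LINT t|lborel. (\<alpha> * D t + \<beta> * E t) * ?c t) = 0"
    by (simp only: distrib_right mult.assoc)
qed

lemma fourier_null_mult_cis:
  assumes "fourier_null b D"
  shows "fourier_null b (\<lambda>t. D t * cis (2 * pi * (of_int k * b) * t))"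
proof -
  have "(LINT t|lborel. D t * cis (2 * pi * (of_int k * b) * t) * cis (2 * pi * (of_int m * b) * t)) = 0" for m :: int
  proof -
    have "D t * cis (2 * pi * (of_int k * b) * t) * cis (2 * pi * (of_int m * b) * t)
        = D t * cis (2 * pi * (of_int (k + m) * b) * t)" for t
      by (simp only: mult.assoc cis_mult) (simp add: algebra_simps)
    then show ?thesis using assms by (simp only: fourier_null_def)
  qed
  then show ?thesis
    using assms by (simp add: fourier_null_def integrable_mult_cis)
qed

lemma fourier_null_mult_polynomial:
  assumes "real_polynomial_function p" "fourier_null b D"
  shows "fourier_null b (\<lambda>t. D t * complex_of_real (p (cis (2 * pi * b * t))))"
  using assms
proof (induction p arbitrary: D)
  case (linear p)
  note D = linear.prems
  interpret bounded_linear p by (rule linear)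
  have p: "p z = Re z * p 1 + Im z * p \<i>" for z
  proof -
    have "p z = p (Re z *\<^sub>R 1 + Im z *\<^sub>R \<i>)" by (rule arg_cong[where f=p]) (simp add: complex_eq_iff)
    then show ?thesis by (simp only: add scale) simp
  qed
  \<comment> \<open>On the circle \<open>p\<close> is a combination of the exponentials of frequency \<open>1\<close> and \<open>-1\<close>.\<close>
  let ?\<alpha> = "complex_of_real (p 1) / 2 + of_real (p \<i>) / (2 * \<i>)"
  let ?\<beta> = "complex_of_real (p 1) / 2 - of_real (p \<i>) / (2 * \<i>)"
  have *: "D t * complex_of_real (p (cis (2 * pi * b * t)))
      = ?\<alpha> * (D t * cis (2 * pi * (of_int 1 * b) * t)) + ?\<beta> * (D t * cis (2 * pi * (of_int (-1) * b) * t))" for t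
    unfolding p[of "cis _"] by (simp add: complex_eq_iff field_simps)
  show ?case unfolding * by (intro fourier_null_lin fourier_null_mult_cis D)
next
  case (const c)
  then show ?case using fourier_null_lin[of b D D "of_real c" 0] by (simp add: mult.commute)
next
  case (add f g)
  then show ?case
    using fourier_null_lin[OF add.IH(1)[OF add.prems] add.IH(2)[OF add.prems], of 1 1]
    by (simp add: distrib_left)
next
  case (mult f g)
  then show ?case using mult.IH(2)[OF mult.IH(1)[OF mult.prems]] by (simp add: mult.assoc)
qed

text \<open>Stone--Weierstrass on the circle, combined with stability under polynomials.\<close>

lemma fourier_null_integral_continuous:
  assumes D: "fourier_null b D" and \<phi>: "continuous_on UNIV \<phi>"
  shows "(LINT t|lborel. D t * complex_of_real (\<phi> (cis (2 * pi * b * t)))) = 0"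
proof -
  have intD: "integrable lborel D" using D by (simp add: fourier_null_def)
  have \<phi>m [measurable]: "\<phi> \<in> borel_measurable borel" by (rule borel_measurable_continuous_onI[OF \<phi>])
  let ?I = "LINT t|lborel. D t * complex_of_real (\<phi> (cis (2 * pi * b * t)))"
  let ?N = "LINT t|lborel. cmod (D t)"
  have "cmod ?I \<le> e * ?N" if e: "0 < e" for e
  proof -
    obtain p where p: "real_polynomial_function p" "\<And>z. z \<in> sphere 0 1 \<Longrightarrow> \<bar>\<phi> z - p z\<bar> < e"
      using Stone_Weierstrass_real_polynomial_function[of "sphere 0 1" \<phi> e] continuous_on_subset[OF \<phi>] e
      by (metis compact_sphere subset_UNIV)
    have pc: "p \<in> borel_measurable borel"
      using p(1) by (intro borel_measurable_continuous_onI continuous_on_polymonial_function) (simp add: real_polynomial_function_eq)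
    note [measurable] = this
    have null: "fourier_null b (\<lambda>t. D t * complex_of_real (p (cis (2 * pi * b * t))))"
      by (rule fourier_null_mult_polynomial[OF p(1) D])
    then have "(LINT t|lborel. D t * complex_of_real (p (cis (2 * pi * b * t))) * cis (2 * pi * (of_int 0 * b) * t)) = 0"
      unfolding fourier_null_def by blast
    then have p0: "(LINT t|lborel. D t * complex_of_real (p (cis (2 * pi * b * t)))) = 0" by simp
    have diff: "integrable lborel (\<lambda>t. D t * complex_of_real (\<phi> (cis (2 * pi * b * t)) - p (cis (2 * pi * b * t))))"
      by (rule integrable_mult_bounded[OF intD, where C=e])
        (use p(2) in \<open>auto intro!: less_imp_le simp flip: of_real_diff\<close>)
    have "?I = (LINT t|lborel. D t * complex_of_real (\<phi> (cis (2 * pi * b * t)) - p (cis (2 * pi * b * t)))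
        + D t * complex_of_real (p (cis (2 * pi * b * t))))"
      by (simp add: algebra_simps)
    also have "\<dots> = (LINT t|lborel. D t * complex_of_real (\<phi> (cis (2 * pi * b * t)) - p (cis (2 * pi * b * t))))"
      using null by (subst Bochner_Integration.integral_add) (auto simp: p0 diff fourier_null_def simp del: of_real_diff)
    also have "cmod \<dots> \<le> (LINT t|lborel. e * cmod (D t))"
    proof (rule Bochner_Integration.integral_norm_bound_integral[OF diff])
      show "integrable lborel (\<lambda>t. e * cmod (D t))" using intD by simp
      fix t
      show "cmod (D t * complex_of_real (\<phi> (cis (2 * pi * b * t)) - p (cis (2 * pi * b * t)))) \<le> e * cmod (D t)"
        using mult_right_mono[OF less_imp_le[OF p(2)[of "cis (2 * pi * b * t)"]], of "cmod (D t)"]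
        by (simp add: norm_mult mult.commute del: of_real_diff)
    qed
    finally show ?thesis by simp
  qed
  then have "cmod ?I \<le> 0 + e" if "0 < e" for e
    using that
  proof -
    have N: "0 \<le> ?N" by simp
    have "cmod ?I \<le> e / (?N + 1) * ?N" using \<open>\<And>e. 0 < e \<Longrightarrow> cmod ?I \<le> e * ?N\<close>[of "e / (?N + 1)"] that N by simp
    also have "e / (x + 1) * x \<le> e" if "0 \<le> x" for x :: real
      using that \<open>0 < e\<close> by (simp add: field_simps)
    from this[OF N] have "e / (?N + 1) * ?N \<le> e" .
    finally show ?thesis by simp
  qed
  then have "cmod ?I \<le> 0" by (rule field_le_epsilon)
  then show ?thesis by simp
qed

lemma fourier_null_integral_open:
  assumes D: "fourier_null b D" and U: "open U"
  shows "(LINT t|lborel. D t * indicator U (cis (2 * pi * b * t))) = 0"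
proof (cases "U = UNIV")
  case True
  have "(LINT t|lborel. D t * cis (2 * pi * (of_int 0 * b) * t)) = 0"
    using D unfolding fourier_null_def by blast
  then show ?thesis by (simp add: True)
next
  case False
  \<comment> \<open>The indicator of an open set is a pointwise limit of continuous functions.\<close>
  define \<phi> where "\<phi> n z = min 1 (real n * infdist z (- U))" for n z
  have \<phi>: "continuous_on UNIV (\<phi> n)" for n unfolding \<phi>_def by (intro continuous_intros)
  have intD: "integrable lborel D" using D by (simp add: fourier_null_def)
  then have Dm [measurable]: "D \<in> borel_measurable borel" using borel_measurable_integrable by fastforce
  have [measurable]: "\<phi> n \<in> borel_measurable borel" for n by (rule borel_measurable_continuous_onI[OF \<phi>])
  have [measurable]: "U \<in> sets borel" using U by simp
  have \<phi>_lim: "(\<lambda>n. \<phi> n z) \<longlonglongrightarrow> indicator U z" for z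
  proof (cases "z \<in> U")
    case True
    then have "0 < infdist z (- U)" using False U infdist_pos_not_in_closed[of "- U" z] by auto
    then obtain k where k: "1 < real k * infdist z (- U)"
      using ex_less_of_nat_mult by blast
    have "\<phi> n z = 1" if "k \<le> n" for n
    proof -
      have "real k * infdist z (- U) \<le> real n * infdist z (- U)"
        using that by (intro mult_right_mono) (auto simp: infdist_nonneg)
      then show ?thesis using k by (simp add: \<phi>_def)
    qed
    then have "\<forall>\<^sub>F n in sequentially. \<phi> n z = 1" by (auto simp: eventually_sequentially)
    then show ?thesis using True by (simp add: tendsto_eventually)
  next
    case False
    then show ?thesis by (simp add: \<phi>_def)
  qed
  have "(\<lambda>n. LINT t|lborel. D t * complex_of_real (\<phi> n (cis (2 * pi * b * t))))
      \<longlonglongrightarrow> (LINT t|lborel. D t * complex_of_real (indicator U (cis (2 * pi * b * t))))"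
  proof (rule integral_dominated_convergence)
    show "integrable lborel (\<lambda>t. cmod (D t))" using intD by simp
    show "AE t in lborel. (\<lambda>n. D t * complex_of_real (\<phi> n (cis (2 * pi * b * t))))
        \<longlonglongrightarrow> D t * complex_of_real (indicator U (cis (2 * pi * b * t)))"
      by (intro AE_I2 tendsto_intros \<phi>_lim)
    have "\<bar>\<phi> n z\<bar> \<le> 1" for n z by (simp add: \<phi>_def infdist_nonneg)
    then show "AE t in lborel. norm (D t * complex_of_real (\<phi> n (cis (2 * pi * b * t)))) \<le> cmod (D t)" for n
      by (intro AE_I2) (simp add: norm_mult mult_left_le)
  qed measurable
  then show ?thesis
    by (simp add: fourier_null_integral_continuous[OF D \<phi>] LIMSEQ_const_iff indicator_def of_bool_def if_distrib cong: if_cong)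
qed

lemma Arg2pi_cis: "0 \<le> x \<Longrightarrow> x < 2 * pi \<Longrightarrow> Arg2pi (cis x) = x"
  using Arg2pi_unique[of 1 x "cis x"] by (simp add: cis_conv_exp)

text \<open>The map \<open>t \<mapsto> exp (2\<pi>i b t)\<close> is a homeomorphism from the open period onto the circle without
  the point 1, with inverse \<open>Arg2pi / (2\<pi>b)\<close>. So every open subset of the period is the preimage of
  an open set of the plane, and the integral of \<open>D\<close> over it vanishes. Open sets generate the Borel
  sets, and a function with vanishing integral over every Borel set is zero.\<close>

lemma fourier_null_imp_zero:
  assumes b: "0 < b" and D: "fourier_null b D"
    and supp: "\<And>t. t \<notin> {0..<1/b} \<Longrightarrow> D t = 0"
  shows "AE t in lborel. D t = 0"
proof (rule sigma_finite_measure.density_zero[OF sigma_finite_lborel])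
  show intD: "integrable lborel D" using D by (simp add: fourier_null_def)
  then have Dm [measurable]: "D \<in> borel_measurable borel" using borel_measurable_integrable by fastforce
  have int_ind: "integrable lborel (\<lambda>t. indicator A t *\<^sub>R D t)" if "A \<in> sets borel" for A
    using integrable_mult_indicator[of A lborel D] intD that by simp
  have open_zero: "(LINT t|lborel. indicator E t *\<^sub>R D t) = 0" if E: "open E" for E
  proof -
    have cont: "continuous_on (- \<real>\<^sub>\<ge>\<^sub>0) (\<lambda>z. Arg2pi z / (2 * pi * b))"
      using b by (intro continuous_intros continuous_at_imp_continuous_on ballI continuous_at_Arg2pi) auto
    define U where "U = - \<real>\<^sub>\<ge>\<^sub>0 \<inter> (\<lambda>z. Arg2pi z / (2 * pi * b)) -` E"
    have U: "open U"
      unfolding U_def by (rule continuous_open_preimage[OF cont _ E]) (simp add: open_Compl)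
    have eq: "indicator E t *\<^sub>R D t = D t * indicator U (cis (2 * pi * b * t))" if t: "t \<noteq> 0" for t
    proof (cases "t \<in> {0..<1/b}")
      case True
      then have r: "0 < 2 * pi * b * t" "2 * pi * b * t < 2 * pi" using t b by (auto simp: field_simps)
      then have A: "Arg2pi (cis (2 * pi * b * t)) = 2 * pi * b * t" by (intro Arg2pi_cis) auto
      have "cis (2 * pi * b * t) \<notin> \<real>\<^sub>\<ge>\<^sub>0"
      proof
        assume "cis (2 * pi * b * t) \<in> \<real>\<^sub>\<ge>\<^sub>0"
        then have "Arg2pi (cis (2 * pi * b * t)) = 0"
          unfolding Arg2pi_eq_0 complex_nonneg_Reals_iff by (simp add: complex_is_Real_iff)
        with A r(1) show False by linarith
      qed
      moreover have "2 * pi * b * t / (2 * pi * b) = t" using b by simp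
      ultimately have "cis (2 * pi * b * t) \<in> U \<longleftrightarrow> t \<in> E" using A by (simp add: U_def)
      then show ?thesis by (simp add: indicator_def)
    next
      case False
      then show ?thesis by (simp add: supp)
    qed
    have [measurable]: "U \<in> sets borel" "E \<in> sets borel" using U E by auto
    have "(LINT t|lborel. indicator E t *\<^sub>R D t) = (LINT t|lborel. D t * indicator U (cis (2 * pi * b * t)))"
      by (intro integral_cong_AE) (use eq AE_lborel_singleton[of 0] in auto)
    then show ?thesis by (simp add: fourier_null_integral_open[OF D U])
  qed
  fix A :: "real set" assume "A \<in> sets lborel"
  then have A: "A \<in> sigma_sets UNIV {S. open S}" by (simp add: sets_borel)
  have "Int_stable {S::real set. open S}" "{S::real set. open S} \<subseteq> Pow UNIV"
    by (auto simp: Int_stable_def)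
  from this A have "(LINT t|lborel. indicator A t *\<^sub>R D t) = 0"
  proof (induction rule: sigma_sets_induct_disjoint)
    case (compl A)
    then have "A \<in> sets borel" by (simp add: sets_borel)
    then have "(LINT t|lborel. indicator UNIV t *\<^sub>R D t - indicator A t *\<^sub>R D t) = 0"
      by (subst Bochner_Integration.integral_diff) (simp_all only: int_ind compl open_zero[OF open_UNIV], simp_all add: intD int_ind)
    moreover have "indicator UNIV t *\<^sub>R D t - indicator A t *\<^sub>R D t = indicator (UNIV - A) t *\<^sub>R D t" for t
      by (simp add: indicator_def)
    ultimately show ?case by simp
  next
    case (union A)
    then have A: "A i \<in> sets borel" for i by (auto simp: sets_borel)
    have "(LINT t:(\<Union>i. A i)|lborel. D t) = (\<Sum>i. (LINT t:A i|lborel. D t))"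
      by (rule lebesgue_integral_countable_add)
        (use union A int_ind in \<open>auto simp: set_integrable_def disjoint_family_on_def\<close>)
    then show ?case using union by (simp add: set_lebesgue_integral_def)
  qed (auto simp: open_zero)
  then show "set_lebesgue_integral lborel A D = 0" by (simp add: set_lebesgue_integral_def)
qed

definition fourier_basis :: "real \<Rightarrow> int \<Rightarrow> real \<Rightarrow> complex" where
  "fourier_basis b m t = indicator {0..<1/b} t * cis (2 * pi * (of_int m * b) * t)"

lemma fourier_basis_L2: "fourier_basis b m \<in> L2"
proof -
  have "(\<lambda>t. indicator {0..<1/b} t :: complex) \<in> L2"
  proof (rule L2I)
    have "(cmod (indicator {0..<1/b} t))\<^sup>2 = indicator {0..<1/b} t" for t :: real
      by (simp add: indicator_def)
    then show "integrable lborel (\<lambda>t. (cmod (indicator {0..<1/b} t))\<^sup>2)"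
      by (simp only:) (intro integrable_real_indicator emeasure_bounded_finite, auto)
  qed measurable
  then have "(\<lambda>t. cis (2 * pi * (of_int m * b) * t) * indicator {0..<1/b} t) \<in> L2"
    by (rule L2_mult_bounded[where C=1]) auto
  then show ?thesis by (simp add: fourier_basis_def[abs_def] mult.commute)
qed

lemma fourier_basis_orthogonal:
  assumes b: "0 < b"
  shows "L2_inner (fourier_basis b m) (fourier_basis b n) = (if m = n then 1 / of_real b else 0)"
proof -
  have prod: "fourier_basis b m t * cnj (fourier_basis b n t)
      = indicator {0..<1/b} t *\<^sub>R cis (2 * pi * (of_int (m - n) * b) * t)" for t
    by (simp add: fourier_basis_def indicator_def cis_cnj cis_mult algebra_simps)
  have eq: "L2_inner (fourier_basis b m) (fourier_basis b n)
      = (LINT t|lborel. indicator {0..1/b} t *\<^sub>R cis (2 * pi * (of_int (m - n) * b) * t))"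
    unfolding L2_inner_def prod
    by (intro integral_cong_AE) (use AE_lborel_singleton[of "1/b"] in \<open>auto simp: indicator_def\<close>)
  show ?thesis
  proof (cases "m = n")
    case True
    then show ?thesis using b unfolding eq by (simp add: scaleR_conv_of_real)
  next
    case False
    define w where "w = 2 * pi * (of_int (m - n) * b)"
    have w: "w \<noteq> 0" using False b by (simp add: w_def)
    have "(LINT t|lborel. indicator {0..1/b} t *\<^sub>R cis (w * t))
        = cis (w * (1/b)) / (\<i> * of_real w) - cis (w * 0) / (\<i> * of_real w)"
    proof (rule integral_FTC_Icc)
      show "0 \<le> 1 / b" using b by simp
      show "((\<lambda>t. cis (w * t) / (\<i> * of_real w)) has_vector_derivative cis (w * x)) (at x within {0..1/b})" for x
        using w unfolding cis_conv_exp of_real_mult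
        by (auto intro!: derivative_eq_intros has_vector_derivative_real_field simp: field_simps)
      show "continuous_on {0..1/b} (\<lambda>t. cis (w * t))" by (intro continuous_intros)
    qed
    moreover have "w * (1/b) = 2 * pi * of_int (m - n)" using b by (simp add: w_def)
    ultimately show ?thesis using False unfolding eq w_def[symmetric] by (simp add: cis_multiple_2pi)
  qed
qed

text \<open>Bessel's inequality: test \<open>F\<close> against its own partial Fourier sum.\<close>

lemma fourier_basis_bessel:
  assumes b: "0 < b"
  shows "bessel (fourier_basis b) (1 / b)"
  unfolding bessel_def
proof (intro conjI ballI allI impI)
  fix F and A :: "int set" assume F: "F \<in> L2" and A: "finite A"
  define c where "c m = L2_inner F (fourier_basis b m)" for m
  define s where "s t = (\<Sum>m\<in>A. c m * fourier_basis b m t)" for t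
  define Q where "Q = (\<Sum>m\<in>A. (cmod (c m))\<^sup>2)"
  have Q: "0 \<le> Q" by (simp add: Q_def sum_nonneg)
  have sL2: "s \<in> L2" unfolding s_def by (intro L2_sum L2_cmult fourier_basis_L2)
  have right: "L2_inner u s = (\<Sum>m\<in>A. cnj (c m) * L2_inner u (fourier_basis b m))" if "u \<in> L2" for u
    using that unfolding s_def[abs_def]
    by (simp add: L2_inner_sum_right L2_cmult fourier_basis_L2 L2_inner_cmult_right)
  have Qc: "of_real Q = (\<Sum>m\<in>A. cnj (c m) * c m)"
    by (simp add: Q_def complex_norm_square mult.commute flip: of_real_power)
  have Fs: "L2_inner F s = of_real Q" unfolding right[OF F] Qc c_def ..
  have es: "L2_inner s (fourier_basis b m) = c m / of_real b" if "m \<in> A" for m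
  proof -
    have "L2_inner s (fourier_basis b m) = (\<Sum>n\<in>A. c n * (if n = m then 1 / of_real b else 0))"
      unfolding s_def[abs_def] fourier_basis_orthogonal[OF b, symmetric]
      by (simp add: L2_inner_sum_left L2_cmult fourier_basis_L2 L2_inner_cmult_left)
    then show ?thesis using A that by (simp add: if_distrib sum.delta' cong: if_cong)
  qed
  have "complex_of_real ((L2_norm s)\<^sup>2) = of_real (Q / b)"
    unfolding L2_inner_self[symmetric] right[OF sL2]
    by (simp add: es Qc sum_divide_distrib)
  then have s2: "(L2_norm s)\<^sup>2 = Q / b" using of_real_eq_iff by blast
  have "Q \<le> L2_norm F * L2_norm s" using L2_Cauchy_Schwarz[OF F sL2] Q by (simp add: Fs)
  then have "Q\<^sup>2 \<le> (L2_norm F * L2_norm s)\<^sup>2" using Q by (rule power_mono)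
  also have "\<dots> = (L2_norm F)\<^sup>2 * (Q / b)" by (simp add: power_mult_distrib s2)
  finally have "Q * Q \<le> (1 / b * (L2_norm F)\<^sup>2) * Q" by (simp add: power2_eq_square ac_simps)
  then have "Q \<le> 1 / b * (L2_norm F)\<^sup>2"
    using Q b mult_right_le_imp_le[of Q Q "1 / b * (L2_norm F)\<^sup>2"] by (cases "Q = 0") auto
  then show "(\<Sum>m\<in>A. (cmod (L2_inner F (fourier_basis b m)))\<^sup>2) \<le> 1 / b * (L2_norm F)\<^sup>2"
    by (simp add: Q_def c_def)
qed (use b in \<open>auto intro: fourier_basis_L2\<close>)

text \<open>If \<open>h\<close> is the weak sum of the Fourier series of \<open>F\<close>, then \<open>F - b h\<close> has vanishing coefficients,
  so \<open>h = F / b\<close> almost everywhere on the period.\<close>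

lemma fourier_parseval:
  assumes b: "0 < b" and F: "F \<in> L2" and H: "H \<in> L2"
    and supp: "\<And>t. t \<notin> {0..<1/b} \<Longrightarrow> H t = 0"
  shows "((\<lambda>m. L2_inner F (fourier_basis b m) * cnj (L2_inner H (fourier_basis b m)))
    has_sum (L2_inner F H / of_real b)) UNIV"
proof -
  note [measurable] = L2_measurable[OF F] L2_measurable[OF H]
  obtain h where h: "frame_image (fourier_basis b) F h"
    using frame_image_exists[OF fourier_basis_bessel[OF b] F] by auto
  then have hL2: "h \<in> L2" by (simp add: frame_image_def)
  note [measurable] = L2_measurable[OF hL2]
  have coeff: "L2_inner h (fourier_basis b m) = L2_inner F (fourier_basis b m) / of_real b" for m
  proof -
    have "((\<lambda>n. L2_inner F (fourier_basis b n) * cnj (L2_inner (fourier_basis b m) (fourier_basis b n)))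
        has_sum L2_inner h (fourier_basis b m)) UNIV"
      using h fourier_basis_L2 unfolding frame_image_def by blast
    moreover have "((\<lambda>n. L2_inner F (fourier_basis b n) * cnj (L2_inner (fourier_basis b m) (fourier_basis b n)))
        has_sum (\<Sum>n\<in>{m}. L2_inner F (fourier_basis b n) * cnj (L2_inner (fourier_basis b m) (fourier_basis b n)))) UNIV"
      by (rule has_sum_finite_neutralI[where B="{m}"]) (auto simp: fourier_basis_orthogonal[OF b])
    ultimately show ?thesis
      using has_sum_unique by (fastforce simp: fourier_basis_orthogonal[OF b])
  qed
  define G where "G t = F t - of_real b * h t" for t
  have GL2: "G \<in> L2" unfolding G_def[abs_def] by (intro L2_diff L2_cmult F hL2)
  note [measurable] = L2_measurable[OF GL2]
  define D where "D t = indicator {0..<1/b} t * G t" for t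
  have G0: "L2_inner G (fourier_basis b m) = 0" for m
    unfolding G_def[abs_def]
    using b by (simp add: L2_inner_diff_left L2_cmult F hL2 fourier_basis_L2 L2_inner_cmult_left coeff)
  have "fourier_null b D"
    unfolding fourier_null_def
  proof (intro conjI allI)
    have D0: "D t = G t * cnj (fourier_basis b 0 t)" for t
      by (simp add: D_def fourier_basis_def indicator_def)
    show "integrable lborel D"
      unfolding D0[abs_def] by (rule L2_inner_integrable[OF GL2 fourier_basis_L2])
    fix m :: int
    have "D t * cis (2 * pi * (of_int m * b) * t) = G t * cnj (fourier_basis b (- m) t)" for t
      by (simp add: D_def fourier_basis_def indicator_def cis_cnj)
    then show "(LINT t|lborel. D t * cis (2 * pi * (of_int m * b) * t)) = 0"
      using G0[of "- m"] by (simp add: L2_inner_def)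
  qed
  then have "AE t in lborel. D t = 0"
    by (rule fourier_null_imp_zero[OF b]) (auto simp: D_def)
  then have "AE t in lborel. h t * cnj (H t) = (1 / of_real b * F t) * cnj (H t)"
  proof eventually_elim
    case (elim t)
    show ?case
    proof (cases "t \<in> {0..<1/b}")
      case True
      then show ?thesis using elim b by (simp add: D_def G_def field_simps)
    qed (simp add: supp)
  qed
  then have "L2_inner h H = L2_inner (\<lambda>t. 1 / of_real b * F t) H"
    by (intro L2_inner_cong_AE) measurable
  also have "\<dots> = L2_inner F H / of_real b" by (simp only: L2_inner_cmult_left) simp
  finally show ?thesis using h H by (auto simp: frame_image_def)
qed

section \<open>Uniform boundedness\<close>

definition L2_bounded_seminorm :: "((real \<Rightarrow> complex) \<Rightarrow> real) \<Rightarrow> real \<Rightarrow> bool" where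
  "L2_bounded_seminorm p C \<longleftrightarrow>
     (\<forall>f\<in>L2. \<forall>h\<in>L2. p (\<lambda>t. f t + h t) \<le> p f + p h) \<and>
     (\<forall>c. \<forall>f\<in>L2. p (\<lambda>t. c * f t) = cmod c * p f) \<and>
     (\<forall>f\<in>L2. 0 \<le> p f \<and> p f \<le> C * L2_norm f)"

text \<open>Because \<open>2 y\<close> is the difference of \<open>x + y\<close> and \<open>x - y\<close>, these cannot both be small.\<close>

lemma L2_seminorm_perturb:
  assumes p: "L2_bounded_seminorm p C" and x: "x \<in> L2" and y: "y \<in> L2"
  shows "p y \<le> max (p (\<lambda>t. x t + y t)) (p (\<lambda>t. x t - y t))"
proof -
  have "2 * p y = p (\<lambda>t. 2 * y t)"
    using p y unfolding L2_bounded_seminorm_def by simp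
  also have "(\<lambda>t. 2 * y t) = (\<lambda>t. (x t + y t) + (-1) * (x t - y t))" by auto
  also have "p \<dots> \<le> p (\<lambda>t. x t + y t) + p (\<lambda>t. (-1) * (x t - y t))"
  proof -
    have "\<forall>f\<in>L2. \<forall>h\<in>L2. p (\<lambda>t. f t + h t) \<le> p f + p h"
      using p by (simp add: L2_bounded_seminorm_def)
    from bspec[OF bspec[OF this L2_add[OF x y]] L2_cmult[OF L2_diff[OF x y], of "-1"]]
    show ?thesis .
  qed
  also have "p (\<lambda>t. (-1) * (x t - y t)) = cmod (-1) * p (\<lambda>t. x t - y t)"
  proof -
    have "\<forall>c. \<forall>f\<in>L2. p (\<lambda>t. c * f t) = cmod c * p f"
      using p by (simp add: L2_bounded_seminorm_def)
    from bspec[OF spec[OF this, of "-1"] L2_diff[OF x y]] show ?thesis .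
  qed
  finally show ?thesis by simp
qed

text \<open>The gliding hump argument. If the operator norms \<open>N i\<close> were unbounded, one could choose
  indices \<open>i n\<close> with \<open>N (i n) > n 4\<^sup>n\<close> and perturb successively by \<open>\<plusminus>4\<^sup>-\<^sup>n u n\<close>, where \<open>u n\<close> lies in
  the unit ball and attains \<open>N (i n)\<close> up to the factor \<open>2/3\<close>. With the right sign the n-th
  perturbation makes the seminorm at least \<open>2/3 4\<^sup>-\<^sup>n N (i n)\<close>. The later ones have total norm at most
  \<open>1/3 4\<^sup>-\<^sup>n\<close>, so at the limit point the seminorm is still at least \<open>n/3\<close>.\<close>

theorem L2_uniform_boundedness:
  fixes p :: "'i \<Rightarrow> (real \<Rightarrow> complex) \<Rightarrow> real"
  assumes p: "\<And>i. L2_bounded_seminorm (p i) (C i)"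
    and pointwise: "\<And>f. f \<in> L2 \<Longrightarrow> \<exists>M. \<forall>i. p i f \<le> M"
  obtains M where "0 \<le> M" "\<And>i f. f \<in> L2 \<Longrightarrow> p i f \<le> M * L2_norm f"
proof -
  define N where "N i = (SUP f\<in>{f \<in> L2. L2_norm f \<le> 1}. p i f)" for i
  have p_add: "p i (\<lambda>t. f t + h t) \<le> p i f + p i h" if "f \<in> L2" "h \<in> L2" for i f h
    using p that unfolding L2_bounded_seminorm_def by blast
  have p_cmult: "p i (\<lambda>t. c * f t) = cmod c * p i f" if "f \<in> L2" for i c f
    using p that unfolding L2_bounded_seminorm_def by blast
  have p_nonneg: "0 \<le> p i f" and p_le: "p i f \<le> C i * L2_norm f" if "f \<in> L2" for i f
    using p that unfolding L2_bounded_seminorm_def by blast+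
  have bdd: "bdd_above (p i ` {f \<in> L2. L2_norm f \<le> 1})" for i
  proof (rule bdd_aboveI2)
    fix f assume f: "f \<in> {f \<in> L2. L2_norm f \<le> 1}"
    then have "C i * L2_norm f \<le> \<bar>C i\<bar> * 1" by (intro mult_mono) auto
    then show "p i f \<le> \<bar>C i\<bar>" using p_le[of f i] f by simp
  qed
  have zero: "(\<lambda>t. 0) \<in> {f \<in> L2. L2_norm f \<le> 1}" by (simp add: L2_norm_def)
  have N0: "0 \<le> N i" for i
    unfolding N_def using p_nonneg[of "\<lambda>t. 0" i] zero by (intro cSUP_upper2[OF bdd zero]) auto
  have N: "p i f \<le> N i * L2_norm f" if f: "f \<in> L2" for i f
  proof (cases "L2_norm f = 0")
    case True
    then show ?thesis using p_le[OF f, of i] by simp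
  next
    case False
    define h where "h t = of_real (1 / L2_norm f) * f t" for t
    have h: "h \<in> {f \<in> L2. L2_norm f \<le> 1}"
      using False unfolding h_def[abs_def] by (simp add: L2_cmult f L2_norm_cmult del: of_real_divide)
    have "p i h \<le> N i" unfolding N_def by (rule cSUP_upper[OF h bdd])
    moreover have "p i h = p i f / L2_norm f"
      using p_cmult[OF f, of i "of_real (1 / L2_norm f)"] by (simp add: h_def[abs_def] norm_divide)
    ultimately show ?thesis using False by (simp add: field_simps order.strict_iff_order)
  qed
  have "\<exists>M. \<forall>i. N i \<le> M"
  proof (rule ccontr)
    assume "\<not> (\<exists>M. \<forall>i. N i \<le> M)"
    then have "\<exists>i. real n * 4 ^ n < N i" for n by (meson not_le)
    then obtain i where i: "\<And>n. real n * 4 ^ n < N (i n)" by metis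
    have "\<exists>u. u \<in> L2 \<and> L2_norm u \<le> 1 \<and> 2/3 * N (i n) < p (i n) u" for n
    proof -
      have "0 < N (i n)" using i[of n] by (meson le_less_trans mult_nonneg_nonneg of_nat_0_le_iff zero_le_numeral zero_le_power)
      then have "2/3 * N (i n) < N (i n)" by simp
      then show ?thesis using less_cSUP_iff[OF _ bdd] zero unfolding N_def by blast
    qed
    then obtain u where u: "\<And>n. u n \<in> L2" "\<And>n. L2_norm (u n) \<le> 1"
        "\<And>n. 2/3 * N (i n) < p (i n) (u n)" by metis
    define v where "v n t = of_real ((1/4) ^ n) * u n t" for n :: nat and t
    have v: "v n \<in> L2" for n unfolding v_def[abs_def] by (intro L2_cmult u)
    have v_norm: "L2_norm (v n) \<le> (1/4) ^ n" for n
      using mult_left_mono[OF u(2)[of n], of "(1/4) ^ n"]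
      unfolding v_def[abs_def] by (simp add: L2_norm_cmult norm_power norm_divide)
    define x where "x = rec_nat (\<lambda>t. 0) (\<lambda>n y. if p (i n) (v n) \<le> p (i n) (\<lambda>t. y t + v n t)
        then (\<lambda>t. y t + v n t) else (\<lambda>t. y t - v n t))"
    have x0: "x 0 = (\<lambda>t. 0)" by (simp add: x_def)
    have x_Suc: "x (Suc n) = (if p (i n) (v n) \<le> p (i n) (\<lambda>t. x n t + v n t)
        then (\<lambda>t. x n t + v n t) else (\<lambda>t. x n t - v n t))" for n by (simp add: x_def)
    have x: "x n \<in> L2" for n
    proof (induction n)
      case (Suc n)
      show ?case unfolding x_Suc using L2_add[OF Suc v] L2_diff[OF Suc v] by simp
    qed (simp add: x0)
    have step: "L2_norm (\<lambda>t. x (Suc n) t - x n t) \<le> (1/4) ^ n" for n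
      using v_norm[of n] by (simp add: x_Suc L2_norm_uminus)
    have hump: "p (i n) (v n) \<le> p (i n) (x (Suc n))" for n
      using L2_seminorm_perturb[OF p x v, of "i n" n n] by (auto simp: x_Suc max_def split: if_splits)
    obtain h where h: "h \<in> L2" "\<And>n. L2_norm (\<lambda>t. x n t - h t) \<le> (1/4) ^ n / (1 - 1/4)"
      using L2_complete_fast[of x "1/4", OF x _ _ step] by auto
    obtain M where M: "\<And>i. p i h \<le> M" using pointwise[OF h(1)] by auto
    obtain n where n: "3 * M < real n" using reals_Archimedean2 by blast
    have "p (i n) (v n) = (1/4) ^ n * p (i n) (u n)"
      unfolding v_def[abs_def] p_cmult[OF u(1)] by (simp add: norm_power norm_divide)
    then have "2/3 * N (i n) * (1/4) ^ n \<le> p (i n) (v n)"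
      using mult_right_mono[OF less_imp_le[OF u(3)[of n]], of "(1/4) ^ n"] by (simp add: mult.commute)
    also have "\<dots> \<le> p (i n) (x (Suc n))" by (rule hump)
    also have "\<dots> = p (i n) (\<lambda>t. h t + (x (Suc n) t - h t))" by simp
    also have "\<dots> \<le> p (i n) h + p (i n) (\<lambda>t. x (Suc n) t - h t)"
      by (intro p_add h L2_diff x)
    also have "p (i n) (\<lambda>t. x (Suc n) t - h t) \<le> N (i n) * ((1/4) ^ Suc n / (1 - 1/4))"
      by (rule order_trans[OF N[OF L2_diff[OF x h(1)]] mult_left_mono[OF h(2) N0]])
    also have "\<dots> = 1/3 * N (i n) * (1/4) ^ n" by simp
    finally have "1/3 * N (i n) * (1/4) ^ n \<le> p (i n) h" by linarith
    then have "1/3 * N (i n) * (1/4) ^ n \<le> M" using M order_trans by blast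
    moreover have "real n / 3 \<le> 1/3 * N (i n) * (1/4) ^ n"
      using less_imp_le[OF i[of n]] by (simp add: field_simps power_one_over)
    ultimately show False using n by simp
  qed
  then obtain M where M: "\<And>i. N i \<le> M" by auto
  show ?thesis
  proof (rule that[of "max M 0"])
    fix i f assume f: "f \<in> L2"
    have "N i * L2_norm f \<le> max M 0 * L2_norm f" using M[of i] by (intro mult_right_mono) auto
    then show "p i f \<le> max M 0 * L2_norm f" using N[OF f, of i] by simp
  qed simp
qed

text \<open>Convergence bounds the partial sums only when both ends are far out. Their differences
  are the one-sided tails, so these are bounded too, and any partial sum consists of differences
  of tails and of a part of one fixed finite block. Negative values of \<open>K\<close> and \<open>L\<close> matter
  because the supremum of the operator norms runs over all integers.\<close>

lemma two_sided_partial_sums_bounded: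
  fixes w :: "int \<Rightarrow> complex"
  assumes "((\<lambda>(K, L). \<Sum>k=-L..K. w k) \<longlongrightarrow> l) (at_top \<times>\<^sub>F at_top)"
  shows "\<exists>M. \<forall>K L. cmod (\<Sum>k=-L..K. w k) \<le> M"
proof -
  have "\<forall>\<^sub>F x in at_top \<times>\<^sub>F at_top. dist (case x of (K, L) \<Rightarrow> \<Sum>k=-L..K. w k) l < 1"
    using assms by (rule tendstoD) simp
  then obtain P Q where PQ: "eventually P at_top" "eventually Q at_top"
    "\<And>K L. P K \<Longrightarrow> Q L \<Longrightarrow> dist (\<Sum>k=-L..K. w k) l < 1"
    unfolding eventually_prod_filter by auto
  obtain N1 N2 where N12: "\<And>K. N1 \<le> K \<Longrightarrow> P K" "\<And>L. N2 \<le> L \<Longrightarrow> Q L"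
    using PQ(1,2) unfolding eventually_at_top_linorder by auto
  define N where "N = max (max N1 N2) 0"
  define R where "R = cmod l + 1"
  have far: "cmod (\<Sum>k=-L..K. w k) \<le> R" if "N \<le> K" "N \<le> L" for K L
    using norm_triangle_ineq2[of "\<Sum>k=-L..K. w k" l] PQ(3)[OF N12, of K L] that
    by (simp add: N_def R_def dist_norm)
  have right: "cmod (\<Sum>k\<in>{N<..x}. w k) \<le> 2 * R" if "N \<le> x" for x
  proof -
    have "{-N..x} = {-N..N} \<union> {N<..x}" using that by (auto simp: N_def)
    then have "(\<Sum>k\<in>{N<..x}. w k) = (\<Sum>k=-N..x. w k) - (\<Sum>k=-N..N. w k)"
      by (simp add: sum.union_disjoint disjoint_iff)
    then show ?thesis
      using norm_triangle_ineq4[of "\<Sum>k=-N..x. w k" "\<Sum>k=-N..N. w k"] far[of x N] far[of N N] that by simp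
  qed
  have left: "cmod (\<Sum>k\<in>{-x..<-N}. w k) \<le> 2 * R" if "N \<le> x" for x
  proof -
    have "{-x..N} = {-x..<-N} \<union> {-N..N}" using that by (auto simp: N_def)
    then have "(\<Sum>k\<in>{-x..<-N}. w k) = (\<Sum>k=-x..N. w k) - (\<Sum>k=-N..N. w k)"
      by (simp add: sum.union_disjoint disjoint_iff)
    then show ?thesis
      using norm_triangle_ineq4[of "\<Sum>k=-x..N. w k" "\<Sum>k=-N..N. w k"] far[of N x] far[of N N] that by simp
  qed
  have R: "0 \<le> R" by (simp add: R_def add_nonneg_nonneg)
  have right': "cmod (\<Sum>k\<in>{-L..K} \<inter> {N<..}. w k) \<le> 4 * R" for K L
  proof -
    define m where "m = max N (-L - 1)"
    have eq: "{-L..K} \<inter> {N<..} = {m<..K}" by (auto simp: m_def)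
    show ?thesis
    proof (cases "m \<le> K")
      case True
      have "{N<..K} = {N<..m} \<union> {m<..K}" using True by (auto simp: m_def)
      then have "(\<Sum>k\<in>{m<..K}. w k) = (\<Sum>k\<in>{N<..K}. w k) - (\<Sum>k\<in>{N<..m}. w k)"
        by (simp add: sum.union_disjoint disjoint_iff)
      then show ?thesis unfolding eq
        using norm_triangle_ineq4[of "\<Sum>k\<in>{N<..K}. w k" "\<Sum>k\<in>{N<..m}. w k"] right[of K] right[of m] True
        by (simp add: m_def)
    qed (use R in \<open>simp add: eq\<close>)
  qed
  have left': "cmod (\<Sum>k\<in>{-L..K} \<inter> {..<-N}. w k) \<le> 4 * R" for K L
  proof -
    define m where "m = max N (-K - 1)"
    have eq: "{-L..K} \<inter> {..<-N} = {-L..<-m}" by (auto simp: m_def)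
    show ?thesis
    proof (cases "m \<le> L")
      case True
      have "{-L..<-N} = {-L..<-m} \<union> {-m..<-N}" using True by (auto simp: m_def)
      then have "(\<Sum>k\<in>{-L..<-m}. w k) = (\<Sum>k\<in>{-L..<-N}. w k) - (\<Sum>k\<in>{-m..<-N}. w k)"
        by (simp add: sum.union_disjoint disjoint_iff)
      then show ?thesis unfolding eq
        using norm_triangle_ineq4[of "\<Sum>k\<in>{-L..<-N}. w k" "\<Sum>k\<in>{-m..<-N}. w k"] left[of L] left[of m] True
        by (simp add: m_def)
    qed (use R in \<open>simp add: eq\<close>)
  qed
  have "cmod (\<Sum>k=-L..K. w k) \<le> 8 * R + (\<Sum>k=-N..N. cmod (w k))" for K L
  proof -
    have split: "{-L..K} = ({-L..K} \<inter> {..<-N}) \<union> ({-L..K} \<inter> {-N..N}) \<union> ({-L..K} \<inter> {N<..})" by auto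
    have "(\<Sum>k=-L..K. w k) = (\<Sum>k\<in>{-L..K} \<inter> {..<-N}. w k) + (\<Sum>k\<in>{-L..K} \<inter> {-N..N}. w k)
        + (\<Sum>k\<in>{-L..K} \<inter> {N<..}. w k)"
      by (subst split, subst sum.union_disjoint, simp, simp, force simp: N_def,
          subst sum.union_disjoint) (auto simp: N_def)
    also have "cmod \<dots> \<le> cmod (\<Sum>k\<in>{-L..K} \<inter> {..<-N}. w k) + cmod (\<Sum>k\<in>{-L..K} \<inter> {-N..N}. w k)
        + cmod (\<Sum>k\<in>{-L..K} \<inter> {N<..}. w k)"
      by (intro order_trans[OF norm_triangle_ineq] add_mono norm_triangle_ineq order_refl)
    also have "\<dots> \<le> 4 * R + (\<Sum>k=-N..N. cmod (w k)) + 4 * R"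
      by (intro add_mono right' left' order_trans[OF norm_sum] sum_mono2) auto
    finally show ?thesis by simp
  qed
  then show ?thesis by blast
qed

section \<open>Translations and cells\<close>

lemma lborel_integral_translate:
  fixes f :: "real \<Rightarrow> 'a :: {banach, second_countable_topology}"
  shows "(LINT t|lborel. f (t - c)) = (LINT t|lborel. f t)"
  using lborel_integral_real_affine[of 1 f "- c"] by simp

lemma AE_lborel_translate:
  fixes P :: "real \<Rightarrow> bool"
  assumes "Measurable.pred borel P" "AE t in lborel. P t"
  shows "AE t in lborel. P (t - c)"
  using AE_borel_affine[of 1 P "- c"] assms by simp

lemma L2_translate:
  assumes f: "f \<in> L2"
  shows "(\<lambda>t. f (t - c)) \<in> L2"
proof (rule L2I)
  note [measurable] = L2_measurable[OF f]
  show "(\<lambda>t. f (t - c)) \<in> borel_measurable borel" by measurable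
  show "integrable lborel (\<lambda>t. (cmod (f (t - c)))\<^sup>2)"
    using lborel_integrable_real_affine[OF L2_integrable_square[OF f], of 1 "- c"] by simp
qed

lemma L2_norm_translate: "L2_norm (\<lambda>t. f (t - c)) = L2_norm f"
  unfolding L2_norm_def using lborel_integral_translate[of "\<lambda>t. (cmod (f t))\<^sup>2" c] by simp

text \<open>This is \<open>[i/b, (i+1)/b)\<close>, a period of the modulations. The description by the floor function
  makes it evident that the cells partition the line and that translation by \<open>k/b\<close> shifts their
  index by \<open>k\<close>.\<close>

definition cell :: "real \<Rightarrow> int \<Rightarrow> real set" where
  "cell b i = {t. \<lfloor>b * t\<rfloor> = i}"

lemma cell_measurable [measurable]: "cell b i \<in> sets borel"
  unfolding cell_def by measurable

lemma cell_0: "0 < b \<Longrightarrow> cell b 0 = {0..<1/b}"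
  by (auto simp: cell_def floor_eq_iff field_simps zero_le_mult_iff)

lemma cell_translate: "0 < b \<Longrightarrow> t - of_int k / b \<in> cell b i \<longleftrightarrow> t \<in> cell b (i + k)"
proof -
  assume "0 < b"
  then have "b * (t - of_int k / b) = b * t - of_int k" by (simp add: field_simps)
  then show ?thesis by (auto simp: cell_def)
qed

lemma cell_bounded:
  assumes "0 < b"
  shows "bounded (cell b i)"
proof (rule bounded_subset)
  show "cell b i \<subseteq> {of_int i / b..(of_int i + 1) / b}"
    using assms by (auto simp: cell_def floor_eq_iff field_simps)
qed simp

lemma L2_indicator:
  assumes "bounded E" and [measurable]: "E \<in> sets borel"
  shows "(\<lambda>t. indicator E t :: complex) \<in> L2"
proof (rule L2I)
  have "(cmod (indicator E t))\<^sup>2 = indicator E t" for t by (simp add: indicator_def)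
  then show "integrable lborel (\<lambda>t. (cmod (indicator E t))\<^sup>2)"
    by (simp only:) (intro integrable_real_indicator emeasure_bounded_finite assms, simp)
qed measurable

lemma filterlim_symmetric_intervals:
  "filterlim (\<lambda>N. {- int N..int N}) (finite_subsets_at_top UNIV) sequentially"
  unfolding filterlim_finite_subsets_at_top
proof (intro allI impI, elim conjE)
  fix X :: "int set" assume X: "finite X"
  obtain M where M: "\<And>x. x \<in> X \<Longrightarrow> \<bar>x\<bar> \<le> M"
    using finite_imageI[OF X, of abs] by (meson Max_ge image_eqI)
  show "\<forall>\<^sub>F N in sequentially. finite {- int N..int N} \<and> X \<subseteq> {- int N..int N} \<and> {- int N..int N} \<subseteq> UNIV"
    using eventually_ge_at_top[of "nat M"]
  proof eventually_elim
    case (elim N)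
    show ?case using M elim by force
  qed
qed

lemma finite_int_subset_interval:
  assumes "finite X"
  obtains N where "X \<subseteq> {- int N..int N}"
proof -
  have "\<forall>\<^sub>F N in sequentially. X \<subseteq> {- int N..int N}"
    using filterlim_symmetric_intervals assms unfolding filterlim_finite_subsets_at_top
    by (auto elim: eventually_mono)
  then show ?thesis using that by (auto simp: eventually_sequentially)
qed

text \<open>Unconditional summability of complex numbers is absolute, so the sum is an ordinary series
  where the series of the moduli is finite, and the default value 0 elsewhere.\<close>

lemma borel_measurable_infsum_int:
  fixes u :: "int \<Rightarrow> real \<Rightarrow> complex"
  assumes [measurable]: "\<And>n. u n \<in> borel_measurable borel"
  shows "(\<lambda>t. \<Sum>\<^sub>\<infinity>n. u n t) \<in> borel_measurable borel"
proof -
  define v where "v n = u (int_decode n)" for n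
  have [measurable]: "v n \<in> borel_measurable borel" for n unfolding v_def by measurable
  have eq: "(\<Sum>\<^sub>\<infinity>n. u n t) = (if (\<Sum>n. ennreal (cmod (v n t))) \<noteq> top then (\<Sum>n. v n t) else 0)" for t
  proof -
    have "(\<Sum>\<^sub>\<infinity>n. u n t) = (\<Sum>\<^sub>\<infinity>n. v n t)"
      unfolding v_def using infsum_reindex_bij_betw[OF bij_int_decode, of "\<lambda>n. u n t"] by simp
    also have "\<dots> = (if (\<Sum>n. ennreal (cmod (v n t))) \<noteq> top then (\<Sum>n. v n t) else 0)"
    proof (cases "summable (\<lambda>n. cmod (v n t))")
      case True
      then have "((\<lambda>n. v n t) has_sum (\<Sum>n. v n t)) UNIV"
        by (rule norm_summable_imp_has_sum[OF _ summable_sums[OF summable_norm_cancel[OF True]]])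
      then have "(\<Sum>\<^sub>\<infinity>n. v n t) = (\<Sum>n. v n t)" by (rule infsumI)
      moreover have "(\<Sum>n. ennreal (cmod (v n t))) \<noteq> top" by (rule ennreal_suminf_neq_top[OF True]) simp
      ultimately show ?thesis by (simp only: if_True not_False_eq_True)
    next
      case False
      then have "\<not> (\<lambda>n. cmod (v n t)) summable_on UNIV"
        using summable_on_UNIV_nonneg_real_iff[of "\<lambda>n. cmod (v n t)"] by simp
      then have "\<not> (\<lambda>n. v n t) summable_on UNIV"
        by (simp only: summable_on_iff_abs_summable_on_complex not_False_eq_True)
      then have "(\<Sum>\<^sub>\<infinity>n. v n t) = 0" by (rule infsum_not_exists)
      moreover have "(\<Sum>n. ennreal (cmod (v n t))) = top"
      proof (rule ccontr)
        assume "(\<Sum>n. ennreal (cmod (v n t))) \<noteq> top"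
        then have "summable (\<lambda>n. cmod (v n t))" by (rule summable_suminf_not_top[rotated]) simp
        with False show False by contradiction
      qed
      ultimately show ?thesis by (simp only: if_False not_True_eq_False simp_thms)
    qed
    finally show ?thesis .
  qed
  show ?thesis unfolding eq by measurable
qed

section \<open>The Gabor system\<close>

lemma gabor_eq: "gabor g a b (m, n) t = cis (2 * pi * (of_int m * b) * t) * g (t - of_int n * a)"
  by (simp add: gabor_def modulate_def translate_def cis_conv_exp mult_ac)

lemma gabor_L2: "g \<in> L2 \<Longrightarrow> gabor g a b p \<in> L2"
proof (cases p)
  fix m n assume g: "g \<in> L2" and p: "p = (m, n)"
  have "gabor g a b p = (\<lambda>t. cis (2 * pi * (of_int m * b) * t) * g (t - of_int n * a))"
    unfolding p by (rule ext) (rule gabor_eq)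
  also have "\<dots> \<in> L2"
    by (rule L2_mult_bounded[where C=1, OF L2_translate[OF g]]) auto
  finally show ?thesis .
qed

lemma preframe_bessel:
  assumes g: "g \<in> L2" and pf: "preframe g a b"
  obtains B where "bessel (gabor g a b) B"
proof -
  from pf obtain B where B: "\<And>f. f \<in> L2 \<Longrightarrow>
      (\<lambda>p. (cmod (L2_inner f (gabor g a b p)))\<^sup>2) summable_on UNIV \<and>
      (\<Sum>\<^sub>\<infinity>p. (cmod (L2_inner f (gabor g a b p)))\<^sup>2) \<le> B * (L2_norm f)\<^sup>2"
    unfolding preframe_def by blast
  have "bessel (gabor g a b) (max B 0)"
    unfolding bessel_def
  proof (intro conjI ballI allI impI)
    fix f and A :: "(int \<times> int) set" assume f: "f \<in> L2" and A: "finite A"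
    have "(\<Sum>p\<in>A. (cmod (L2_inner f (gabor g a b p)))\<^sup>2) \<le> (\<Sum>\<^sub>\<infinity>p. (cmod (L2_inner f (gabor g a b p)))\<^sup>2)"
      using B[OF f] A by (intro finite_sum_le_infsum) auto
    also have "\<dots> \<le> B * (L2_norm f)\<^sup>2" using B[OF f] by blast
    also have "\<dots> \<le> max B 0 * (L2_norm f)\<^sup>2" by (intro mult_right_mono) auto
    finally show "(\<Sum>p\<in>A. (cmod (L2_inner f (gabor g a b p)))\<^sup>2) \<le> max B 0 * (L2_norm f)\<^sup>2" .
  qed (auto intro: gabor_L2[OF g])
  then show ?thesis by (rule that)
qed

text \<open>The modulations are \<open>1/b\<close>-periodic, so the inner product of a function living in one cell
  with a Gabor function is a Fourier coefficient on the basic period.\<close>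

lemma gabor_inner_eq_fourier:
  assumes b: "0 < b" and supp: "\<forall>t. t \<notin> cell b i \<longrightarrow> f t = 0"
  shows "L2_inner f (gabor g a b (m, n)) =
    L2_inner (\<lambda>t. f (t + of_int i / b) * cnj (g (t + of_int i / b - of_int n * a))) (fourier_basis b m)"
proof -
  have "L2_inner f (gabor g a b (m, n))
      = (LINT t|lborel. f (t - - (of_int i / b)) * cnj (gabor g a b (m, n) (t - - (of_int i / b))))"
    unfolding L2_inner_def by (rule lborel_integral_translate[symmetric])
  also have "\<dots> = L2_inner (\<lambda>t. f (t + of_int i / b) * cnj (g (t + of_int i / b - of_int n * a))) (fourier_basis b m)"
    unfolding L2_inner_def
  proof (rule Bochner_Integration.integral_cong[OF refl])
    fix t
    have "2 * pi * (of_int m * b) * (t + of_int i / b) = 2 * pi * (of_int m * b) * t + 2 * pi * of_int (m * i)"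
      using b by (simp add: field_simps)
    then have per: "cis (2 * pi * (of_int m * b) * (t + of_int i / b)) = cis (2 * pi * (of_int m * b) * t)"
      by (simp only: cis_mult[symmetric] cis_multiple_2pi Ints_of_int mult_1_right)
    show "f (t - - (of_int i / b)) * cnj (gabor g a b (m, n) (t - - (of_int i / b)))
       = f (t + of_int i / b) * cnj (g (t + of_int i / b - of_int n * a)) * cnj (fourier_basis b m t)"
    proof (cases "t \<in> {0..<1/b}")
      case True
      then show ?thesis by (simp add: gabor_eq fourier_basis_def per)
    next
      case False
      then have "t + of_int i / b \<notin> cell b i"
        using cell_translate[OF b, of t "- i" i] by (simp add: cell_0[OF b])
      then show ?thesis by (simp add: supp)
    qed
  qed
  finally show ?thesis .
qed

lemma gabor_parseval:
  assumes b: "0 < b" and f: "\<forall>t. t \<notin> cell b i \<longrightarrow> f t = 0" and h: "\<forall>t. t \<notin> cell b j \<longrightarrow> h t = 0"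
    and F: "(\<lambda>t. f t * cnj (g (t - of_int n * a))) \<in> L2" and H: "(\<lambda>t. h t * cnj (g (t - of_int n * a))) \<in> L2"
  shows "((\<lambda>m. L2_inner f (gabor g a b (m, n)) * cnj (L2_inner h (gabor g a b (m, n)))) has_sum
    (LINT t|lborel. f (t - of_int (j - i) / b) * cnj (h t) *
       (g (t - of_int n * a) * cnj (g (t - of_int n * a - of_int (j - i) / b)))) / of_real b) UNIV"
proof -
  define F' where "F' t = f (t + of_int i / b) * cnj (g (t + of_int i / b - of_int n * a))" for t
  define H' where "H' t = h (t + of_int j / b) * cnj (g (t + of_int j / b - of_int n * a))" for t
  have F': "F' \<in> L2" and H': "H' \<in> L2"
    using L2_translate[OF F, of "- (of_int i / b)"] L2_translate[OF H, of "- (of_int j / b)"]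
    by (simp_all add: F'_def[abs_def] H'_def[abs_def])
  have supp: "H' t = 0" if "t \<notin> {0..<1/b}" for t
  proof -
    have "t + of_int j / b \<notin> cell b j"
      using that cell_translate[OF b, of t "- j" j] by (simp add: cell_0[OF b])
    then show ?thesis by (simp add: H'_def h)
  qed
  have "L2_inner F' H' = (LINT t|lborel. F' (t - of_int j / b) * cnj (H' (t - of_int j / b)))"
    unfolding L2_inner_def by (rule lborel_integral_translate[symmetric])
  also have "\<dots> = (LINT t|lborel. f (t - of_int (j - i) / b) * cnj (h t) *
       (g (t - of_int n * a) * cnj (g (t - of_int n * a - of_int (j - i) / b))))"
  proof (rule Bochner_Integration.integral_cong[OF refl])
    fix t
    have *: "t - of_int j / b + of_int i / b = t - of_int (j - i) / b"
      "t - of_int (j - i) / b - of_int n * a = t - of_int n * a - of_int (j - i) / b"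
      by (simp_all add: diff_divide_distrib)
    show "F' (t - of_int j / b) * cnj (H' (t - of_int j / b)) = f (t - of_int (j - i) / b) * cnj (h t) *
       (g (t - of_int n * a) * cnj (g (t - of_int n * a - of_int (j - i) / b)))"
      by (simp only: F'_def H'_def diff_add_cancel complex_cnj_mult complex_cnj_cnj *) (simp only: ac_simps)
  qed
  finally have inner: "L2_inner F' H' = (LINT t|lborel. f (t - of_int (j - i) / b) * cnj (h t) *
       (g (t - of_int n * a) * cnj (g (t - of_int n * a - of_int (j - i) / b))))" .
  have "((\<lambda>m. L2_inner F' (fourier_basis b m) * cnj (L2_inner H' (fourier_basis b m)))
      has_sum (L2_inner F' H' / of_real b)) UNIV"
    by (rule fourier_parseval[OF b F' H' supp])
  then show ?thesis
    unfolding inner gabor_inner_eq_fourier[OF b f] gabor_inner_eq_fourier[OF b h]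
    by (simp only: F'_def[abs_def] H'_def[abs_def])
qed

text \<open>For a subset \<open>E\<close> of one cell, the Bessel inequality for \<open>1\<^sub>E\<close> says that \<open>\<Sum>n. |g (t - na)|\<^sup>2\<close> has
  mean at most \<open>bB\<close> on \<open>E\<close>. Letting \<open>E\<close> be the set where the sum is larger than \<open>bB\<close> shows that
  this set is a null set.\<close>

lemma gabor_square_sum_le:
  assumes b: "0 < b" and g: "g \<in> L2" and bes: "bessel (gabor g a b) B"
  shows "AE t in lborel. \<forall>N. (\<Sum>n=-int N..int N. (cmod (g (t - of_int n * a)))\<^sup>2) \<le> b * B"
proof -
  note [measurable] = L2_measurable[OF g]
  define \<phi> where "\<phi> N t = (\<Sum>n=-int N..int N. (cmod (g (t - of_int n * a)))\<^sup>2)" for N t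
  have \<phi>m [measurable]: "\<phi> N \<in> borel_measurable borel" for N unfolding \<phi>_def by measurable
  have "AE t in lborel. t \<in> cell b i \<longrightarrow> \<phi> N t \<le> b * B" for i N
  proof -
    define E where "E = {t \<in> cell b i. b * B < \<phi> N t}"
    have Em [measurable]: "E \<in> sets borel" unfolding E_def by measurable
    define f :: "real \<Rightarrow> complex" where "f = indicator E"
    have bE: "bounded E" by (rule bounded_subset[OF cell_bounded[OF b, of i]]) (auto simp: E_def)
    have f: "f \<in> L2" unfolding f_def using L2_indicator[OF bE Em] by simp
    have supp: "\<forall>t. t \<notin> cell b i \<longrightarrow> f t = 0" by (simp add: f_def E_def)
    have F: "(\<lambda>t. f t * cnj (g (t - of_int n * a))) \<in> L2" for n
      unfolding f_def using L2_restrict[OF L2_cnj[OF L2_translate[OF g]] Em] by simp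
    have gint: "integrable lborel (\<lambda>t. indicator E t * (cmod (g (t - of_int n * a)))\<^sup>2)" for n
      using integrable_mult_indicator[OF _ L2_integrable_square[OF L2_translate[OF g]], of E "of_int n * a"]
      by simp
    define I where "I n = (LINT t|lborel. indicator E t * (cmod (g (t - of_int n * a)))\<^sup>2)" for n
    have hs: "((\<lambda>m. (cmod (L2_inner f (gabor g a b (m, n))))\<^sup>2) has_sum (I n / b)) UNIV" for n
    proof -
      have "f t * cnj (f t) * (g (t - of_int n * a) * cnj (g (t - of_int n * a)))
          = complex_of_real (indicator E t * (cmod (g (t - of_int n * a)))\<^sup>2)" for t
        by (simp add: f_def indicator_def complex_norm_square flip: of_real_power)
      then have "((\<lambda>m. complex_of_real ((cmod (L2_inner f (gabor g a b (m, n))))\<^sup>2)) has_sum of_real (I n / b)) UNIV"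
        using gabor_parseval[OF b supp supp F F, of n]
        by (simp add: complex_norm_square[symmetric] I_def del: of_real_power of_real_mult)
      then show ?thesis by (simp only: has_sum_of_real_iff)
    qed
    have "((\<lambda>m. \<Sum>n\<in>A. (cmod (L2_inner f (gabor g a b (m, n))))\<^sup>2) has_sum (\<Sum>n\<in>A. I n / b)) UNIV"
      if "finite A" for A
      using that by (induction A) (auto intro: has_sum_add hs)
    from this[OF finite_atLeastAtMost_int]
    have "((\<lambda>m. \<Sum>n=-int N..int N. (cmod (L2_inner f (gabor g a b (m, n))))\<^sup>2) has_sum (\<Sum>n=-int N..int N. I n / b)) UNIV" .
    then have "(\<Sum>n=-int N..int N. I n / b) \<le> B * (L2_norm f)\<^sup>2"
    proof (rule has_sum_le_finite_sums)
      fix M :: "int set" assume M: "finite M"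
      have "(\<Sum>m\<in>M. \<Sum>n=-int N..int N. (cmod (L2_inner f (gabor g a b (m, n))))\<^sup>2)
          = (\<Sum>p\<in>M \<times> {-int N..int N}. (cmod (L2_inner f (gabor g a b p)))\<^sup>2)"
        by (simp add: sum.cartesian_product case_prod_unfold)
      also have "\<dots> \<le> B * (L2_norm f)\<^sup>2" by (rule bessel_sum_le[OF bes f]) (use M in simp)
      finally show "(\<Sum>m\<in>M. \<Sum>n=-int N..int N. (cmod (L2_inner f (gabor g a b (m, n))))\<^sup>2) \<le> B * (L2_norm f)\<^sup>2" .
    qed
    also have "(L2_norm f)\<^sup>2 = (LINT t|lborel. indicator E t)"
      unfolding L2_norm_square by (rule Bochner_Integration.integral_cong[OF refl]) (simp add: f_def indicator_def)
    finally have "(\<Sum>n=-int N..int N. I n) \<le> b * B * (LINT t|lborel. indicator E t)"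
      using b by (simp add: field_simps sum_divide_distrib[symmetric])
    also have "(\<Sum>n=-int N..int N. I n) = (LINT t|lborel. indicator E t * \<phi> N t)"
      unfolding I_def \<phi>_def sum_distrib_left by (rule Bochner_Integration.integral_sum[symmetric]) (rule gint)
    finally have le: "(LINT t|lborel. indicator E t * \<phi> N t) \<le> b * B * (LINT t|lborel. indicator E t)" .
    have int1: "integrable lborel (\<lambda>t. indicator E t * \<phi> N t)"
      unfolding \<phi>_def sum_distrib_left by (intro Bochner_Integration.integrable_sum gint)
    have int2: "integrable lborel (indicator E :: real \<Rightarrow> real)"
      by (intro integrable_real_indicator emeasure_bounded_finite bE) simp
    have int: "integrable lborel (\<lambda>t. indicator E t * \<phi> N t - b * B * indicator E t)"
      using int1 int2 by simp
    have nonneg: "AE t in lborel. 0 \<le> indicator E t * \<phi> N t - b * B * indicator E t"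
      by (intro AE_I2) (auto simp: indicator_def E_def)
    have "(LINT t|lborel. indicator E t * \<phi> N t - b * B * indicator E t) = 0"
      using le int1 int2 integral_nonneg_AE[OF nonneg] by simp
    then have "AE t in lborel. indicator E t * \<phi> N t - b * B * indicator E t = 0"
      using integral_nonneg_eq_0_iff_AE[OF int nonneg] by simp
    then show ?thesis
    proof eventually_elim
      case (elim t)
      then show ?case by (cases "t \<in> E") (auto simp: E_def)
    qed
  qed
  then have "AE t in lborel. \<forall>i N. t \<in> cell b i \<longrightarrow> \<phi> N t \<le> b * B"
    by (simp only: AE_all_countable simp_thms)
  then show ?thesis
    by eventually_elim (simp add: cell_def \<phi>_def)
qed

lemma gabor_window_bounded:
  assumes b: "0 < b" and g: "g \<in> L2" and bes: "bessel (gabor g a b) B"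
  shows "AE t in lborel. cmod (g (t - of_int n * a)) \<le> sqrt (b * B)"
  using gabor_square_sum_le[OF assms]
proof eventually_elim
  case (elim t)
  have "(cmod (g (t - of_int n * a)))\<^sup>2 \<le> (\<Sum>n=-int (nat \<bar>n\<bar>)..int (nat \<bar>n\<bar>). (cmod (g (t - of_int n * a)))\<^sup>2)"
    by (rule member_le_sum) auto
  then show ?case using elim by (intro real_le_rsqrt) (meson order_trans)
qed

lemma walnut_coeff_measurable:
  assumes g: "g \<in> L2"
  shows "walnut_coeff g a b k \<in> borel_measurable borel"
proof -
  note [measurable] = L2_measurable[OF g]
  show ?thesis unfolding walnut_coeff_def[abs_def] by (rule borel_measurable_infsum_int) measurable
qed

text \<open>By the Cauchy--Schwarz inequality for sums, the preceding bound carries over to the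
  correlation functions, uniformly in the partial sums.\<close>

lemma
  assumes b: "0 < b" and g: "g \<in> L2" and bes: "bessel (gabor g a b) B"
  shows walnut_coeff_partial_sums: "AE t in lborel.
      (\<forall>N. cmod (\<Sum>n=-int N..int N. g (t - of_int n * a) * cnj (g (t - of_int n * a - of_int k / b))) \<le> b * B) \<and>
      (\<lambda>N. \<Sum>n=-int N..int N. g (t - of_int n * a) * cnj (g (t - of_int n * a - of_int k / b)))
        \<longlonglongrightarrow> walnut_coeff g a b k t"
    and walnut_coeff_bounded: "AE t in lborel. cmod (walnut_coeff g a b k t) \<le> b * B"
proof -
  note [measurable] = L2_measurable[OF g]
  have shifted: "AE t in lborel. \<forall>N. (\<Sum>n=-int N..int N. (cmod (g (t - of_int k / b - of_int n * a)))\<^sup>2) \<le> b * B"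
    by (rule AE_lborel_translate[OF _ gabor_square_sum_le[OF assms]]) measurable
  show *: "AE t in lborel.
      (\<forall>N. cmod (\<Sum>n=-int N..int N. g (t - of_int n * a) * cnj (g (t - of_int n * a - of_int k / b))) \<le> b * B) \<and>
      (\<lambda>N. \<Sum>n=-int N..int N. g (t - of_int n * a) * cnj (g (t - of_int n * a - of_int k / b)))
        \<longlonglongrightarrow> walnut_coeff g a b k t"
    using gabor_square_sum_le[OF assms] shifted
  proof eventually_elim
    case (elim t)
    let ?c = "\<lambda>n. g (t - of_int n * a) * cnj (g (t - of_int n * a - of_int k / b))"
    have C: "0 \<le> b * B" using b bes by (simp add: bessel_def)
    have abs_le: "(\<Sum>n=-int N..int N. cmod (?c n)) \<le> b * B" for N
    proof -
      have comm: "t - of_int n * a - of_int k / b = t - of_int k / b - of_int n * a" for n by simp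
      have "(\<Sum>n=-int N..int N. cmod (?c n)) \<le> sqrt (\<Sum>n=-int N..int N. (cmod (g (t - of_int n * a)))\<^sup>2)
          * sqrt (\<Sum>n=-int N..int N. (cmod (g (t - of_int k / b - of_int n * a)))\<^sup>2)"
        unfolding comm by (rule Cauchy_Schwarz_sum_cmod)
      also have "\<dots> \<le> sqrt (b * B) * sqrt (b * B)"
        by (intro mult_mono real_sqrt_le_mono elim[THEN spec]) (use C in \<open>auto simp: sum_nonneg\<close>)
      finally show ?thesis using C by simp
    qed
    have "(\<lambda>n. cmod (?c n)) summable_on UNIV"
    proof (rule nonneg_bounded_partial_sums_imp_summable_on[where C="b * B"])
      show "\<forall>\<^sub>F X in finite_subsets_at_top UNIV. (\<Sum>n\<in>X. cmod (?c n)) \<le> b * B"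
      proof (rule eventually_finite_subsets_at_top_weakI)
        fix X :: "int set" assume "finite X"
        then obtain N where "X \<subseteq> {- int N..int N}" by (rule finite_int_subset_interval)
        then have "(\<Sum>n\<in>X. cmod (?c n)) \<le> (\<Sum>n=-int N..int N. cmod (?c n))" by (intro sum_mono2) auto
        then show "(\<Sum>n\<in>X. cmod (?c n)) \<le> b * B" using abs_le[of N] by simp
      qed
    qed simp
    then have "?c summable_on UNIV" by (simp only: summable_on_iff_abs_summable_on_complex)
    then have "(?c has_sum walnut_coeff g a b k t) UNIV"
      unfolding walnut_coeff_def by (rule has_sum_infsum)
    then have "(\<lambda>N. sum ?c {-int N..int N}) \<longlonglongrightarrow> walnut_coeff g a b k t"
      unfolding has_sum_def by (rule filterlim_compose[OF _ filterlim_symmetric_intervals])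
    moreover have "cmod (sum ?c {-int N..int N}) \<le> b * B" for N
      by (rule order_trans[OF norm_sum abs_le])
    ultimately show ?case by blast
  qed
  show "AE t in lborel. cmod (walnut_coeff g a b k t) \<le> b * B"
    using *
  proof eventually_elim
    case (elim t)
    then show ?case by (intro tendsto_upperbound[OF tendsto_norm[OF conjunct2[OF elim]]]) auto
  qed
qed

definition walnut_term ::
    "(real \<Rightarrow> complex) \<Rightarrow> real \<Rightarrow> real \<Rightarrow> int \<Rightarrow> (real \<Rightarrow> complex) \<Rightarrow> real \<Rightarrow> complex" where
  "walnut_term g a b k f t = f (t - of_int k / b) * walnut_coeff g a b k t"

lemma
  assumes b: "0 < b" and g: "g \<in> L2" and bes: "bessel (gabor g a b) B" and f: "f \<in> L2"
  shows walnut_term_L2: "walnut_term g a b k f \<in> L2"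
    and walnut_term_norm: "L2_norm (walnut_term g a b k f) \<le> b * B * L2_norm f"
proof -
  note [measurable] = walnut_coeff_measurable[OF g]
  have eq: "walnut_term g a b k f = (\<lambda>t. walnut_coeff g a b k t * f (t - of_int k / b))"
    by (rule ext) (simp add: walnut_term_def mult.commute)
  show "walnut_term g a b k f \<in> L2"
    unfolding eq by (rule L2_mult_bounded[OF L2_translate[OF f] _ walnut_coeff_bounded[OF b g bes]]) measurable
  have "L2_norm (walnut_term g a b k f) \<le> b * B * L2_norm (\<lambda>t. f (t - of_int k / b))"
    unfolding eq
    by (rule L2_norm_mult_bounded[OF L2_translate[OF f] _ walnut_coeff_bounded[OF b g bes]])
      (use b bes in \<open>auto simp: bessel_def\<close>)
  then show "L2_norm (walnut_term g a b k f) \<le> b * B * L2_norm f" by (simp add: L2_norm_translate)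
qed

text \<open>The Walnut representation for functions living in single cells: all but one of the terms
  of the Walnut series of \<open>f\<close> vanish on the cell of \<open>h\<close>. Parseval's identity evaluates the sum
  over the modulations, dominated convergence the sum over the translations.\<close>

lemma frame_image_inner_cell:
  assumes b: "0 < b" and g: "g \<in> L2" and bes: "bessel (gabor g a b) B"
    and f: "f \<in> L2" "\<forall>t. t \<notin> cell b i \<longrightarrow> f t = 0" and h: "h \<in> L2" "\<forall>t. t \<notin> cell b j \<longrightarrow> h t = 0"
    and s: "frame_image (gabor g a b) f s"
  shows "L2_inner s h = L2_inner (walnut_term g a b (j - i) f) h / of_real b"
proof -
  note [measurable] = L2_measurable[OF g] L2_measurable[OF f(1)] L2_measurable[OF h(1)] walnut_coeff_measurable[OF g]
  define k where "k = j - i"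
  define G where "G n t = g (t - of_int n * a) * cnj (g (t - of_int n * a - of_int k / b))" for n t
  define P where "P t = f (t - of_int k / b) * cnj (h t)" for t
  have [measurable]: "G n \<in> borel_measurable borel" for n unfolding G_def by measurable
  have P_int: "integrable lborel P"
    unfolding P_def by (rule L2_inner_integrable[OF L2_translate[OF f(1)] h(1)])
  then have [measurable]: "P \<in> borel_measurable borel" using borel_measurable_integrable by fastforce
  have C: "0 \<le> b * B" using b bes by (simp add: bessel_def)
  have mult_g: "(\<lambda>t. u t * cnj (g (t - of_int n * a))) \<in> L2" if "u \<in> L2" for u n
  proof -
    have "(\<lambda>t. cnj (g (t - of_int n * a)) * u t) \<in> L2"
      by (rule L2_mult_bounded[OF that, where C="sqrt (b * B)"]) (use gabor_window_bounded[OF b g bes] in auto)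
    then show ?thesis by (simp add: mult.commute)
  qed
  have "((\<lambda>p. L2_inner f (gabor g a b p) * cnj (L2_inner h (gabor g a b p))) has_sum L2_inner s h) (UNIV \<times> UNIV)"
    using s h(1) unfolding frame_image_def by simp
  then have "((\<lambda>(n, m). L2_inner f (gabor g a b (m, n)) * cnj (L2_inner h (gabor g a b (m, n)))) has_sum L2_inner s h)
      (UNIV \<times> UNIV)"
    by (subst (asm) has_sum_swap) simp
  then have "((\<lambda>n. (LINT t|lborel. P t * G n t) / of_real b) has_sum L2_inner s h) UNIV"
  proof (rule has_sum_SigmaD)
    fix n :: int
    show "((\<lambda>m. case (n, m) of (n, m) \<Rightarrow> L2_inner f (gabor g a b (m, n)) * cnj (L2_inner h (gabor g a b (m, n))))
        has_sum ((LINT t|lborel. P t * G n t) / of_real b)) UNIV"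
      using gabor_parseval[OF b f(2) h(2) mult_g[OF f(1)] mult_g[OF h(1)], of n]
      by (simp add: P_def G_def k_def)
  qed
  then have "(\<lambda>N. \<Sum>n=-int N..int N. (LINT t|lborel. P t * G n t) / of_real b) \<longlonglongrightarrow> L2_inner s h"
    unfolding has_sum_def by (rule filterlim_compose[OF _ filterlim_symmetric_intervals])
  moreover have "(\<lambda>N. \<Sum>n=-int N..int N. (LINT t|lborel. P t * G n t) / of_real b)
      \<longlonglongrightarrow> (LINT t|lborel. P t * walnut_coeff g a b k t) / of_real b"
  proof -
    have PG_int: "integrable lborel (\<lambda>t. P t * G n t)" for n
    proof -
      have "P t * G n t = (f (t - of_int k / b) * cnj (g ((t - of_int k / b) - of_int n * a))) * cnj (h t * cnj (g (t - of_int n * a)))" for t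
        by (simp add: P_def G_def algebra_simps)
      then show ?thesis
        using L2_inner_integrable[OF L2_translate[OF mult_g[OF f(1), of n], of "of_int k / b"] mult_g[OF h(1), of n]] by simp
    qed
    have sum_eq: "(\<Sum>n=-int N..int N. (LINT t|lborel. P t * G n t) / of_real b)
        = (LINT t|lborel. P t * (\<Sum>n=-int N..int N. G n t)) / of_real b" for N
      unfolding sum_divide_distrib[symmetric] sum_distrib_left
      by (subst Bochner_Integration.integral_sum) (auto simp: PG_int)
    have part: "AE t in lborel. (\<forall>N. cmod (\<Sum>n=-int N..int N. G n t) \<le> b * B) \<and>
        (\<lambda>N. \<Sum>n=-int N..int N. G n t) \<longlonglongrightarrow> walnut_coeff g a b k t"
      unfolding G_def by (rule walnut_coeff_partial_sums[OF b g bes])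
    have "(\<lambda>N. LINT t|lborel. P t * (\<Sum>n=-int N..int N. G n t)) \<longlonglongrightarrow> (LINT t|lborel. P t * walnut_coeff g a b k t)"
    proof (rule integral_dominated_convergence)
      show "integrable lborel (\<lambda>t. cmod (P t) * (b * B))" using P_int by simp
      show "AE t in lborel. (\<lambda>N. P t * (\<Sum>n=-int N..int N. G n t)) \<longlonglongrightarrow> P t * walnut_coeff g a b k t"
        using part by eventually_elim (auto intro: tendsto_intros)
      show "AE t in lborel. cmod (P t * (\<Sum>n=-int N..int N. G n t)) \<le> cmod (P t) * (b * B)" for N
        using part by eventually_elim (auto simp: norm_mult intro: mult_left_mono)
    qed measurable
    then show ?thesis unfolding sum_eq by (intro tendsto_divide tendsto_const) (use b in auto)
  qed
  ultimately have "L2_inner s h = (LINT t|lborel. P t * walnut_coeff g a b k t) / of_real b"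
    by (rule LIMSEQ_unique)
  also have "(LINT t|lborel. P t * walnut_coeff g a b k t) = L2_inner (walnut_term g a b k f) h"
    unfolding L2_inner_def by (simp add: P_def walnut_term_def mult_ac)
  finally show ?thesis by (simp add: k_def)
qed

section \<open>Convergence of the Walnut series\<close>

lemma walnut_sum_eq: "walnut_sum g a b K L f = (\<lambda>t. \<Sum>k=-L..K. walnut_term g a b k f t)"
  by (rule ext) (simp add: walnut_sum_def walnut_term_def)

lemma walnut_sum_add:
  "walnut_sum g a b K L (\<lambda>t. f t + h t) = (\<lambda>t. walnut_sum g a b K L f t + walnut_sum g a b K L h t)"
  by (rule ext) (simp add: walnut_sum_def distrib_right sum.distrib)

lemma walnut_sum_cmult:
  "walnut_sum g a b K L (\<lambda>t. c * f t) = (\<lambda>t. c * walnut_sum g a b K L f t)"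
  by (rule ext) (simp add: walnut_sum_def mult.assoc sum_distrib_left)

lemma walnut_sum_diff:
  "walnut_sum g a b K L (\<lambda>t. f t - h t) = (\<lambda>t. walnut_sum g a b K L f t - walnut_sum g a b K L h t)"
  by (rule ext) (simp add: walnut_sum_def left_diff_distrib sum_subtractf)

lemma walnut_sum_L2:
  assumes "0 < b" "g \<in> L2" "bessel (gabor g a b) B" "f \<in> L2"
  shows "walnut_sum g a b K L f \<in> L2"
  unfolding walnut_sum_eq by (intro L2_sum walnut_term_L2[OF assms])

lemma walnut_sum_norm:
  assumes "0 < b" "g \<in> L2" "bessel (gabor g a b) B" "f \<in> L2"
  shows "L2_norm (walnut_sum g a b K L f) \<le> of_nat (card {-L..K}) * (b * B) * L2_norm f"
proof -
  have "L2_norm (walnut_sum g a b K L f) \<le> (\<Sum>k=-L..K. L2_norm (walnut_term g a b k f))"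
    unfolding walnut_sum_eq by (intro L2_norm_sum_le walnut_term_L2[OF assms])
  also have "\<dots> \<le> (\<Sum>k=-L..K. b * B * L2_norm f)"
    by (intro sum_mono walnut_term_norm[OF assms])
  finally show ?thesis by simp
qed

text \<open>On the cell where the k-th Walnut term of \<open>f\<close> lives it agrees with \<open>b\<close> times the frame
  operator, because both have the same inner products with all functions on this cell. So the
  Walnut sums of \<open>f\<close> are truncations of one square integrable function.\<close>

lemma walnut_term_cell:
  assumes b: "0 < b" and g: "g \<in> L2" and bes: "bessel (gabor g a b) B"
    and f: "f \<in> L2" "\<forall>t. t \<notin> cell b i \<longrightarrow> f t = 0" and s: "frame_image (gabor g a b) f s"
  shows "AE t in lborel. walnut_term g a b k f t = of_real b * (indicator (cell b (i + k)) t * s t)"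
proof -
  define \<tau> where "\<tau> = walnut_term g a b k f"
  have sL2: "s \<in> L2" using s by (simp add: frame_image_def)
  have \<tau>: "\<tau> \<in> L2" unfolding \<tau>_def by (rule walnut_term_L2[OF b g bes f(1)])
  have \<tau>_supp: "\<tau> t = 0" if "t \<notin> cell b (i + k)" for t
    using that f(2) cell_translate[OF b, of t k i] by (simp add: \<tau>_def walnut_term_def)
  define s' where "s' t = indicator (cell b (i + k)) t * s t" for t
  have s': "s' \<in> L2" unfolding s'_def by (rule L2_restrict[OF sL2 cell_measurable])
  define D where "D t = s' t - 1 / of_real b * \<tau> t" for t
  have D: "D \<in> L2" unfolding D_def by (intro L2_diff s' L2_cmult \<tau>)
  have D_supp: "\<forall>t. t \<notin> cell b (i + k) \<longrightarrow> D t = 0"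
    by (simp add: D_def s'_def \<tau>_supp)
  have "L2_inner s D = L2_inner \<tau> D / of_real b"
    using frame_image_inner_cell[OF b g bes f D D_supp s] by (simp add: \<tau>_def)
  moreover have "L2_inner s' D = L2_inner s D"
    unfolding L2_inner_def
    by (rule Bochner_Integration.integral_cong[OF refl]) (use D_supp in \<open>auto simp: s'_def indicator_def\<close>)
  moreover have "L2_inner D D = L2_inner s' D - 1 / of_real b * L2_inner \<tau> D"
    by (subst (1) D_def[abs_def]) (simp only: L2_inner_diff_left s' L2_cmult \<tau> D L2_inner_cmult_left)
  ultimately have "L2_inner D D = 0" by simp
  then have "L2_norm D = 0" unfolding L2_inner_self by simp
  from L2_norm_zero_AE[OF D this] show ?thesis
  proof eventually_elim
    case (elim t)
    then show ?case using b by (simp add: D_def s'_def \<tau>_def field_simps)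
  qed
qed

lemma far_measurable [measurable]: "{t :: real. int M < \<bar>\<lfloor>b * t\<rfloor>\<bar>} \<in> sets borel"
proof -
  have "{t. int M < \<bar>\<lfloor>b * t\<rfloor>\<bar>} = - (\<Union>i\<in>{- int M..int M}. cell b i)"
    by (auto simp: cell_def) (metis abs_le_iff atLeastAtMost_iff minus_le_iff not_less)
  then show ?thesis by auto
qed

text \<open>The cells whose index has modulus at most \<open>M\<close> exhaust the line as \<open>M\<close> grows.\<close>

lemma L2_far_part_tendsto_0:
  assumes f: "f \<in> L2"
  shows "(\<lambda>M. L2_norm (\<lambda>t. indicator {t. int M < \<bar>\<lfloor>b * t\<rfloor>\<bar>} t * f t)) \<longlonglongrightarrow> 0"
proof -
  note [measurable] = L2_measurable[OF f]
  have "(\<lambda>M. LINT t|lborel. (cmod (indicator {t. int M < \<bar>\<lfloor>b * t\<rfloor>\<bar>} t * f t))\<^sup>2) \<longlonglongrightarrow> (LINT t::real|lborel. 0 :: real)"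
  proof (rule integral_dominated_convergence)
    show "integrable lborel (\<lambda>t. (cmod (f t))\<^sup>2)" by (rule L2_integrable_square[OF f])
    have "(\<lambda>M. (cmod (indicator {t. int M < \<bar>\<lfloor>b * t\<rfloor>\<bar>} t * f t))\<^sup>2) \<longlonglongrightarrow> 0" for t
    proof (rule tendsto_eventually)
      show "\<forall>\<^sub>F M in sequentially. (cmod (indicator {t. int M < \<bar>\<lfloor>b * t\<rfloor>\<bar>} t * f t))\<^sup>2 = 0"
        using eventually_ge_at_top[of "nat \<bar>\<lfloor>b * t\<rfloor>\<bar>"] by eventually_elim (simp add: indicator_def)
    qed
    then show "AE t in lborel. (\<lambda>M. (cmod (indicator {t. int M < \<bar>\<lfloor>b * t\<rfloor>\<bar>} t * f t))\<^sup>2) \<longlonglongrightarrow> 0" by simp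
    show "AE t in lborel. norm ((cmod (indicator {t. int M < \<bar>\<lfloor>b * t\<rfloor>\<bar>} t * f t))\<^sup>2) \<le> (cmod (f t))\<^sup>2" for M
      by (intro AE_I2) (simp add: indicator_def)
  qed measurable
  from tendsto_real_sqrt[OF this] show ?thesis by (simp add: L2_norm_def)
qed

lemma eventually_prod_at_top:
  "\<forall>\<^sub>F (K, L) in at_top \<times>\<^sub>F at_top. (c :: int) \<le> K \<and> c \<le> L"
  unfolding eventually_prod_filter
  by (intro exI[of _ "\<lambda>x. c \<le> x"] conjI eventually_ge_at_top) auto

lemma walnut_tendsto_cell:
  assumes b: "0 < b" and g: "g \<in> L2" and bes: "bessel (gabor g a b) B"
    and f: "f \<in> L2" "\<forall>t. t \<notin> cell b i \<longrightarrow> f t = 0" and s: "frame_image (gabor g a b) f s"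
  shows "L2_tendsto (\<lambda>(K, L). walnut_sum g a b K L f) (\<lambda>t. of_real b * s t) (at_top \<times>\<^sub>F at_top)"
  unfolding L2_tendsto_def
proof (intro conjI)
  have sL2: "s \<in> L2" using s by (simp add: frame_image_def)
  note [measurable] = L2_measurable[OF sL2] L2_measurable[OF walnut_sum_L2[OF b g bes f(1)]]
  show "(\<lambda>t. of_real b * s t) \<in> L2" by (rule L2_cmult[OF sL2])
  show "\<forall>\<^sub>F x in at_top \<times>\<^sub>F at_top. (case x of (K, L) \<Rightarrow> walnut_sum g a b K L f) \<in> L2"
    using walnut_sum_L2[OF b g bes f(1)] by (intro always_eventually) auto
  have AE_term: "AE t in lborel. \<forall>k. walnut_term g a b k f t = of_real b * (indicator (cell b (i + k)) t * s t)"
    unfolding AE_all_countable using walnut_term_cell[OF b g bes f s] by blast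
  have bound: "L2_norm (\<lambda>t. walnut_sum g a b K L f t - of_real b * s t)
      \<le> b * L2_norm (\<lambda>t. indicator {t. int M < \<bar>\<lfloor>b * t\<rfloor>\<bar>} t * s t)"
    if KL: "int M + \<bar>i\<bar> \<le> K" "int M + \<bar>i\<bar> \<le> L" for K L M
  proof -
    define A where "A = {t. \<lfloor>b * t\<rfloor> - i \<notin> {-L..K}}"
    have [measurable]: "A \<in> sets borel" unfolding A_def by measurable
    have far: "int M < \<bar>\<lfloor>b * t\<rfloor>\<bar>" if "t \<in> A" for t
      using that KL unfolding A_def by simp linarith
    have "AE t in lborel. walnut_sum g a b K L f t - of_real b * s t
        = (- of_real b * indicator A t) * (indicator {t. int M < \<bar>\<lfloor>b * t\<rfloor>\<bar>} t * s t)"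
      using AE_term
    proof eventually_elim
      case (elim t)
      have cell: "t \<in> cell b (i + k) \<longleftrightarrow> k = \<lfloor>b * t\<rfloor> - i" for k by (auto simp: cell_def)
      have "walnut_sum g a b K L f t = (\<Sum>k=-L..K. if k = \<lfloor>b * t\<rfloor> - i then of_real b * s t else 0)"
        unfolding walnut_sum_eq elim[THEN spec] indicator_def cell by (rule sum.cong[OF refl]) auto
      also have "\<dots> = (if t \<in> A then 0 else of_real b * s t)" by (simp add: A_def)
      finally show ?case using far[of t] by (auto simp: indicator_def)
    qed
    then have "L2_norm (\<lambda>t. walnut_sum g a b K L f t - of_real b * s t)
        = L2_norm (\<lambda>t. (- of_real b * indicator A t) * (indicator {t. int M < \<bar>\<lfloor>b * t\<rfloor>\<bar>} t * s t))"
      by (rule L2_norm_cong_AE[rotated 2]) measurable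
    also have "\<dots> \<le> b * L2_norm (\<lambda>t. indicator {t. int M < \<bar>\<lfloor>b * t\<rfloor>\<bar>} t * s t)"
    proof (rule L2_norm_mult_bounded)
      show "(\<lambda>t. indicator {t. int M < \<bar>\<lfloor>b * t\<rfloor>\<bar>} t * s t) \<in> L2" by (rule L2_restrict[OF sL2]) measurable
      show "AE t in lborel. cmod (- of_real b * indicator A t) \<le> b"
        using b by (intro AE_I2) (simp add: indicator_def)
    qed (use b in auto)
    finally show ?thesis .
  qed
  show "((\<lambda>x. L2_norm (\<lambda>t. (case x of (K, L) \<Rightarrow> walnut_sum g a b K L f) t - of_real b * s t)) \<longlongrightarrow> 0)
      (at_top \<times>\<^sub>F at_top)"
  proof (rule tendstoI)
    fix e :: real assume e: "0 < e"
    have "(\<lambda>M. b * L2_norm (\<lambda>t. indicator {t. int M < \<bar>\<lfloor>b * t\<rfloor>\<bar>} t * s t)) \<longlonglongrightarrow> b * 0"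
      by (intro tendsto_intros L2_far_part_tendsto_0 sL2)
    then have "\<forall>\<^sub>F M in sequentially. b * L2_norm (\<lambda>t. indicator {t. int M < \<bar>\<lfloor>b * t\<rfloor>\<bar>} t * s t) < e"
      using e by (intro order_tendstoD) auto
    then obtain M where M: "b * L2_norm (\<lambda>t. indicator {t. int M < \<bar>\<lfloor>b * t\<rfloor>\<bar>} t * s t) < e"
      by (auto simp: eventually_sequentially)
    show "\<forall>\<^sub>F x in at_top \<times>\<^sub>F at_top. dist (L2_norm (\<lambda>t. (case x of (K, L) \<Rightarrow> walnut_sum g a b K L f) t - of_real b * s t)) 0 < e"
      using eventually_prod_at_top[of "int M + \<bar>i\<bar>"]
    proof eventually_elim
      case (elim x)
      then show ?case using bound[of M "fst x" "snd x"] M by (simp add: case_prod_unfold dist_real_def)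
    qed
  qed
qed

lemma L2_tendsto_add:
  assumes "L2_tendsto u h F" "L2_tendsto u' h' F"
  shows "L2_tendsto (\<lambda>i t. u i t + u' i t) (\<lambda>t. h t + h' t) F"
  unfolding L2_tendsto_def
proof (intro conjI)
  have h: "h \<in> L2" "h' \<in> L2" and u: "\<forall>\<^sub>F i in F. u i \<in> L2" "\<forall>\<^sub>F i in F. u' i \<in> L2"
    and lim: "((\<lambda>i. L2_norm (\<lambda>t. u i t - h t)) \<longlongrightarrow> 0) F" "((\<lambda>i. L2_norm (\<lambda>t. u' i t - h' t)) \<longlongrightarrow> 0) F"
    using assms by (auto simp: L2_tendsto_def)
  show "(\<lambda>t. h t + h' t) \<in> L2" by (rule L2_add[OF h])
  show "\<forall>\<^sub>F i in F. (\<lambda>t. u i t + u' i t) \<in> L2" using u by eventually_elim (rule L2_add)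
  have "((\<lambda>i. L2_norm (\<lambda>t. u i t - h t) + L2_norm (\<lambda>t. u' i t - h' t)) \<longlongrightarrow> 0) F"
    using tendsto_add[OF lim] by simp
  moreover have "\<forall>\<^sub>F i in F. norm (L2_norm (\<lambda>t. (u i t + u' i t) - (h t + h' t)))
      \<le> L2_norm (\<lambda>t. u i t - h t) + L2_norm (\<lambda>t. u' i t - h' t)"
    using u
  proof eventually_elim
    case (elim i)
    then show ?case using L2_norm_triangle[OF L2_diff[OF elim(1) h(1)] L2_diff[OF elim(2) h(2)]]
      by (simp add: algebra_simps)
  qed
  ultimately show "((\<lambda>i. L2_norm (\<lambda>t. (u i t + u' i t) - (h t + h' t))) \<longlongrightarrow> 0) F"
    by (rule Lim_null_comparison[rotated])
qed

lemma walnut_tendsto_finite_cells: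
  assumes b: "0 < b" and g: "g \<in> L2" and bes: "bessel (gabor g a b) B"
    and f: "f \<in> L2" and "finite A"
  shows "\<exists>s. frame_image (gabor g a b) (\<lambda>t. \<Sum>i\<in>A. indicator (cell b i) t * f t) s \<and>
    L2_tendsto (\<lambda>(K, L). walnut_sum g a b K L (\<lambda>t. \<Sum>i\<in>A. indicator (cell b i) t * f t))
      (\<lambda>t. of_real b * s t) (at_top \<times>\<^sub>F at_top)"
  using \<open>finite A\<close>
proof induction
  case empty
  have "frame_image (gabor g a b) (\<lambda>t. 0) (\<lambda>t. 0)"
    by (simp add: frame_image_def L2_inner_def)
  moreover have "L2_tendsto (\<lambda>(K, L). walnut_sum g a b K L (\<lambda>t. 0)) (\<lambda>t. of_real b * 0) (at_top \<times>\<^sub>F at_top)"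
    by (simp add: L2_tendsto_def walnut_sum_def[abs_def] case_prod_unfold L2_norm_def)
  ultimately show ?case by auto
next
  case (insert j A)
  define f1 where "f1 t = indicator (cell b j) t * f t" for t
  define f2 where "f2 t = (\<Sum>i\<in>A. indicator (cell b i) t * f t)" for t
  have f1: "f1 \<in> L2" and f2: "f2 \<in> L2"
    unfolding f1_def[abs_def] f2_def[abs_def] by (intro L2_sum L2_restrict[OF f] cell_measurable)+
  have supp: "\<forall>t. t \<notin> cell b j \<longrightarrow> f1 t = 0" by (simp add: f1_def)
  obtain s1 where s1: "frame_image (gabor g a b) f1 s1" using frame_image_exists[OF bes f1] by auto
  obtain s2 where s2: "frame_image (gabor g a b) f2 s2"
    "L2_tendsto (\<lambda>(K, L). walnut_sum g a b K L f2) (\<lambda>t. of_real b * s2 t) (at_top \<times>\<^sub>F at_top)"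
    using insert.IH unfolding f2_def[abs_def] by auto
  have sum: "(\<lambda>t. \<Sum>i\<in>insert j A. indicator (cell b i) t * f t) = (\<lambda>t. f1 t + f2 t)"
    by (rule ext) (simp only: sum.insert[OF insert.hyps] f1_def f2_def)
  have "frame_image (gabor g a b) (\<lambda>t. f1 t + f2 t) (\<lambda>t. s1 t + s2 t)"
    by (rule frame_image_add[OF bes f1 f2 s1 s2(1)])
  moreover have "L2_tendsto (\<lambda>(K, L). walnut_sum g a b K L (\<lambda>t. f1 t + f2 t))
      (\<lambda>t. of_real b * (s1 t + s2 t)) (at_top \<times>\<^sub>F at_top)"
    using L2_tendsto_add[OF walnut_tendsto_cell[OF b g bes f1 supp s1] s2(2)]
    by (simp add: walnut_sum_add case_prod_unfold distrib_left)
  ultimately show ?case unfolding sum by blast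
qed

text \<open>The restriction of \<open>f\<close> to finitely many cells is close to \<open>f\<close>. Passing to it changes the partial
  sums little, uniformly in \<open>K\<close> and \<open>L\<close>, and changes the limit little because the frame operator is
  bounded.\<close>

lemma walnut_tendsto_of_bounded:
  assumes b: "0 < b" and g: "g \<in> L2" and bes: "bessel (gabor g a b) B"
    and R: "0 \<le> R" "\<And>K L f. f \<in> L2 \<Longrightarrow> L2_norm (walnut_sum g a b K L f) \<le> R * L2_norm f"
    and f: "f \<in> L2" and s: "frame_image (gabor g a b) f s"
  shows "L2_tendsto (\<lambda>(K, L). walnut_sum g a b K L f) (\<lambda>t. of_real b * s t) (at_top \<times>\<^sub>F at_top)"
  unfolding L2_tendsto_def
proof (intro conjI)
  have sL2: "s \<in> L2" using s by (simp add: frame_image_def)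
  show bs: "(\<lambda>t. of_real b * s t) \<in> L2" by (rule L2_cmult[OF sL2])
  show "\<forall>\<^sub>F x in at_top \<times>\<^sub>F at_top. (case x of (K, L) \<Rightarrow> walnut_sum g a b K L f) \<in> L2"
    using walnut_sum_L2[OF b g bes f] by (intro always_eventually) auto
  have B: "0 \<le> B" using bes by (simp add: bessel_def)
  show "((\<lambda>x. L2_norm (\<lambda>t. (case x of (K, L) \<Rightarrow> walnut_sum g a b K L f) t - of_real b * s t)) \<longlongrightarrow> 0)
      (at_top \<times>\<^sub>F at_top)"
  proof (rule tendstoI)
    fix e :: real assume e: "0 < e"
    have "(\<lambda>M. (R + b * B) * L2_norm (\<lambda>t. indicator {t. int M < \<bar>\<lfloor>b * t\<rfloor>\<bar>} t * f t)) \<longlonglongrightarrow> (R + b * B) * 0"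
      by (intro tendsto_intros L2_far_part_tendsto_0 f)
    then have "\<forall>\<^sub>F M in sequentially. (R + b * B) * L2_norm (\<lambda>t. indicator {t. int M < \<bar>\<lfloor>b * t\<rfloor>\<bar>} t * f t) < e / 2"
      using e by (intro order_tendstoD) auto
    then obtain M where M: "(R + b * B) * L2_norm (\<lambda>t. indicator {t. int M < \<bar>\<lfloor>b * t\<rfloor>\<bar>} t * f t) < e / 2"
      by (auto simp: eventually_sequentially)
    define f' where "f' t = (\<Sum>i=-int M..int M. indicator (cell b i) t * f t)" for t
    have f': "f' \<in> L2" unfolding f'_def[abs_def] by (intro L2_sum L2_restrict[OF f] cell_measurable)
    have far: "(\<lambda>t. f t - f' t) = (\<lambda>t. indicator {t. int M < \<bar>\<lfloor>b * t\<rfloor>\<bar>} t * f t)"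
    proof
      fix t
      have "f' t = (\<Sum>i=-int M..int M. if i = \<lfloor>b * t\<rfloor> then f t else 0)"
        unfolding f'_def by (rule sum.cong[OF refl]) (auto simp: cell_def indicator_def)
      also have "\<dots> = (if \<bar>\<lfloor>b * t\<rfloor>\<bar> \<le> int M then f t else 0)" by (auto simp: abs_le_iff)
      finally show "f t - f' t = indicator {t. int M < \<bar>\<lfloor>b * t\<rfloor>\<bar>} t * f t" by (auto simp: indicator_def)
    qed
    obtain s' where s': "frame_image (gabor g a b) f' s'"
      "L2_tendsto (\<lambda>(K, L). walnut_sum g a b K L f') (\<lambda>t. of_real b * s' t) (at_top \<times>\<^sub>F at_top)"
      using walnut_tendsto_finite_cells[OF b g bes f, of "{-int M..int M}"] unfolding f'_def[abs_def] by auto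
    have s'L2: "s' \<in> L2" using s' by (simp add: frame_image_def)
    have bs': "(\<lambda>t. of_real b * s' t) \<in> L2" by (rule L2_cmult[OF s'L2])
    have "L2_norm (\<lambda>t. s t - s' t) \<le> B * L2_norm (\<lambda>t. f t - f' t)"
      by (rule frame_image_norm_le[OF bes L2_diff[OF f f'] frame_image_diff[OF bes f f' s s'(1)]])
    then have s_close: "L2_norm (\<lambda>t. of_real b * s' t - of_real b * s t) \<le> b * B * L2_norm (\<lambda>t. f t - f' t)"
      using b L2_norm_cmult[of "of_real b" "\<lambda>t. s' t - s t"] L2_norm_diff_commute[of s s']
      by (simp add: right_diff_distrib mult.assoc)
    have "((\<lambda>x. L2_norm (\<lambda>t. (case x of (K, L) \<Rightarrow> walnut_sum g a b K L f') t - of_real b * s' t)) \<longlongrightarrow> 0)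
        (at_top \<times>\<^sub>F at_top)" using s'(2) by (simp add: L2_tendsto_def)
    then have "\<forall>\<^sub>F x in at_top \<times>\<^sub>F at_top.
        L2_norm (\<lambda>t. (case x of (K, L) \<Rightarrow> walnut_sum g a b K L f') t - of_real b * s' t) < e / 2"
      using e by (intro order_tendstoD) auto
    then show "\<forall>\<^sub>F x in at_top \<times>\<^sub>F at_top. dist (L2_norm (\<lambda>t. (case x of (K, L) \<Rightarrow> walnut_sum g a b K L f) t - of_real b * s t)) 0 < e"
    proof eventually_elim
      case (elim x)
      obtain K L where x: "x = (K, L)" by fastforce
      let ?W = "walnut_sum g a b K L"
      have W: "?W f \<in> L2" "?W f' \<in> L2" using walnut_sum_L2[OF b g bes] f f' by auto
      have "L2_norm (\<lambda>t. ?W f t - of_real b * s t)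
          \<le> L2_norm (\<lambda>t. ?W f t - ?W f' t) + L2_norm (\<lambda>t. ?W f' t - of_real b * s t)"
        by (rule L2_norm_triangle_diff[OF W bs])
      also have "L2_norm (\<lambda>t. ?W f' t - of_real b * s t)
          \<le> L2_norm (\<lambda>t. ?W f' t - of_real b * s' t) + L2_norm (\<lambda>t. of_real b * s' t - of_real b * s t)"
        by (rule L2_norm_triangle_diff[OF W(2) bs' bs])
      also have "L2_norm (\<lambda>t. ?W f t - ?W f' t) \<le> R * L2_norm (\<lambda>t. f t - f' t)"
        using R(2)[OF L2_diff[OF f f'], of K L] by (simp add: walnut_sum_diff)
      finally have "L2_norm (\<lambda>t. ?W f t - of_real b * s t)
          \<le> (R + b * B) * L2_norm (\<lambda>t. f t - f' t) + L2_norm (\<lambda>t. ?W f' t - of_real b * s' t)"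
        using s_close by (simp add: distrib_right)
      then show ?case using elim M unfolding far by (simp add: x dist_real_def)
    qed
  qed
qed

section \<open>Boundedness of the partial sums\<close>

lemma walnut_opnorm_finite_iff:
  assumes b: "0 < b" and g: "g \<in> L2" and bes: "bessel (gabor g a b) B"
  shows "(SUP (K, L)\<in>UNIV. L2_opnorm (walnut_sum g a b K L)) < \<infinity> \<longleftrightarrow>
    (\<exists>R\<ge>0. \<forall>K L. \<forall>f\<in>L2. L2_norm (walnut_sum g a b K L f) \<le> R * L2_norm f)"
proof
  assume "(SUP (K, L)\<in>UNIV. L2_opnorm (walnut_sum g a b K L)) < \<infinity>"
  then obtain R where R: "0 \<le> R" "(SUP (K, L)\<in>UNIV. L2_opnorm (walnut_sum g a b K L)) = ennreal R"
    by (cases "SUP (K, L)\<in>UNIV. L2_opnorm (walnut_sum g a b K L)") auto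
  have unit: "L2_norm (walnut_sum g a b K L f) \<le> R" if f: "f \<in> L2" "L2_norm f \<le> 1" for K L f
  proof -
    have "ennreal (L2_norm (walnut_sum g a b K L f)) \<le> L2_opnorm (walnut_sum g a b K L)"
      unfolding L2_opnorm_def
      by (rule SUP_upper2[of f]) (use f walnut_sum_L2[OF b g bes f(1)] in auto)
    also have "\<dots> \<le> ennreal R"
      unfolding R(2)[symmetric] by (rule SUP_upper2[of "(K, L)"]) auto
    finally show ?thesis using R(1) by simp
  qed
  have "L2_norm (walnut_sum g a b K L f) \<le> R * L2_norm f" if f: "f \<in> L2" for K L f
  proof (cases "L2_norm f = 0")
    case True
    then show ?thesis using walnut_sum_norm[OF b g bes f, of K L] by simp
  next
    case False
    let ?c = "complex_of_real (1 / L2_norm f)"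
    have "L2_norm (walnut_sum g a b K L (\<lambda>t. ?c * f t)) \<le> R"
    proof (rule unit[OF L2_cmult[OF f]])
      show "L2_norm (\<lambda>t. ?c * f t) \<le> 1"
        unfolding L2_norm_cmult using False by (simp add: norm_divide)
    qed
    then show ?thesis
      unfolding walnut_sum_cmult L2_norm_cmult using False
      by (simp add: norm_divide field_simps order.strict_iff_order)
  qed
  then show "\<exists>R\<ge>0. \<forall>K L. \<forall>f\<in>L2. L2_norm (walnut_sum g a b K L f) \<le> R * L2_norm f"
    using R(1) by blast
next
  assume "\<exists>R\<ge>0. \<forall>K L. \<forall>f\<in>L2. L2_norm (walnut_sum g a b K L f) \<le> R * L2_norm f"
  then obtain R where R: "0 \<le> R" "\<And>K L f. f \<in> L2 \<Longrightarrow> L2_norm (walnut_sum g a b K L f) \<le> R * L2_norm f"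
    by blast
  have "L2_opnorm (walnut_sum g a b K L) \<le> ennreal R" for K L
    unfolding L2_opnorm_def
  proof (rule SUP_least)
    fix f assume f: "f \<in> {f \<in> L2. L2_norm f \<le> 1}"
    have "L2_norm (walnut_sum g a b K L f) \<le> R * L2_norm f" using R(2) f by simp
    also have "\<dots> \<le> R * 1" using f R(1) by (intro mult_left_mono) auto
    finally show "(if walnut_sum g a b K L f \<in> L2 then ennreal (L2_norm (walnut_sum g a b K L f)) else \<infinity>) \<le> ennreal R"
      using walnut_sum_L2[OF b g bes] f by (simp add: ennreal_leI)
  qed
  then have "(SUP (K, L)\<in>UNIV. L2_opnorm (walnut_sum g a b K L)) \<le> ennreal R"
    by (intro SUP_least) auto
  then show "(SUP (K, L)\<in>UNIV. L2_opnorm (walnut_sum g a b K L)) < \<infinity>"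
    by (auto intro: le_less_trans)
qed

text \<open>The Banach--Steinhaus theorem is used twice: for fixed \<open>f\<close> the functionals
  \<open>\<langle>S\<^sub>K\<^sub>L f, \<cdot>\<rangle>\<close> are uniformly bounded, which bounds \<open>S\<^sub>K\<^sub>L f\<close>; then the operators are uniformly
  bounded.\<close>

lemma walnut_bounded_of_inner_convergent:
  assumes b: "0 < b" and g: "g \<in> L2" and bes: "bessel (gabor g a b) B"
    and conv: "\<And>f h. f \<in> L2 \<Longrightarrow> h \<in> L2 \<Longrightarrow>
      \<exists>l. ((\<lambda>(K, L). L2_inner (walnut_sum g a b K L f) h) \<longlongrightarrow> l) (at_top \<times>\<^sub>F at_top)"
  shows "\<exists>R\<ge>0. \<forall>K L. \<forall>f\<in>L2. L2_norm (walnut_sum g a b K L f) \<le> R * L2_norm f"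
proof -
  define W where "W x = walnut_sum g a b (fst x) (snd x)" for x
  have W: "W x f \<in> L2" if "f \<in> L2" for x f
    unfolding W_def by (rule walnut_sum_L2[OF b g bes that])
  have inner_bounded: "\<exists>M. \<forall>x. cmod (L2_inner (W x f) h) \<le> M" if f: "f \<in> L2" and h: "h \<in> L2" for f h
  proof -
    have eq: "L2_inner (walnut_sum g a b K L f) h = (\<Sum>k=-L..K. L2_inner (walnut_term g a b k f) h)" for K L
      unfolding walnut_sum_eq by (rule L2_inner_sum_left[OF walnut_term_L2[OF b g bes f] h])
    obtain l where "((\<lambda>(K, L). \<Sum>k=-L..K. L2_inner (walnut_term g a b k f) h) \<longlongrightarrow> l) (at_top \<times>\<^sub>F at_top)"
      using conv[OF f h] unfolding eq by blast
    from two_sided_partial_sums_bounded[OF this] show ?thesis by (auto simp: W_def eq)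
  qed
  have norm_bounded: "\<exists>M. \<forall>x. L2_norm (W x f) \<le> M" if f: "f \<in> L2" for f
  proof -
    have semi: "L2_bounded_seminorm (\<lambda>h. cmod (L2_inner (W x f) h)) (L2_norm (W x f))" for x
      unfolding L2_bounded_seminorm_def
      by (auto simp: L2_inner_add_right W f L2_inner_cmult_right norm_mult norm_triangle_ineq L2_Cauchy_Schwarz)
    obtain M where M: "0 \<le> M" "\<And>x h. h \<in> L2 \<Longrightarrow> cmod (L2_inner (W x f) h) \<le> M * L2_norm h"
      using L2_uniform_boundedness[of "\<lambda>x h. cmod (L2_inner (W x f) h)", OF semi inner_bounded[OF f]] by blast
    have "L2_norm (W x f) \<le> M" for x by (rule L2_norm_le_of_inner[OF W[OF f] M(2) M(1)])
    then show ?thesis by blast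
  qed
  have semi: "L2_bounded_seminorm (\<lambda>f. L2_norm (W x f)) (of_nat (card {- snd x..fst x}) * (b * B))" for x
    unfolding L2_bounded_seminorm_def
  proof (intro conjI ballI allI)
    fix f h :: "real \<Rightarrow> complex" and c assume f: "f \<in> L2"
    show "L2_norm (W x (\<lambda>t. c * f t)) = cmod c * L2_norm (W x f)"
      by (simp add: W_def walnut_sum_cmult L2_norm_cmult)
    show "L2_norm (W x f) \<le> of_nat (card {- snd x..fst x}) * (b * B) * L2_norm f"
      unfolding W_def by (rule walnut_sum_norm[OF b g bes f])
    assume h: "h \<in> L2"
    show "L2_norm (W x (\<lambda>t. f t + h t)) \<le> L2_norm (W x f) + L2_norm (W x h)"
      using L2_norm_triangle[OF W[OF f, of x] W[OF h, of x]] by (simp add: W_def walnut_sum_add)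
  qed simp
  obtain R where "0 \<le> R" "\<And>x f. f \<in> L2 \<Longrightarrow> L2_norm (W x f) \<le> R * L2_norm f"
    using L2_uniform_boundedness[of "\<lambda>x f. L2_norm (W x f)", OF semi norm_bounded] by blast
  then show ?thesis by (auto simp: W_def intro!: exI[of _ R])
qed

text \<open>Polarization reduces the sesquilinear form to its diagonal. It is what makes convergence of
  the quadratic form as strong as weak operator convergence.\<close>

lemma walnut_polarization:
  assumes b: "0 < b" and g: "g \<in> L2" and bes: "bessel (gabor g a b) B" and f: "f \<in> L2" and h: "h \<in> L2"
  shows "L2_inner (walnut_sum g a b K L f) h =
    (\<Sum>c\<in>{1, -1, \<i>, -\<i>}. c * L2_inner (walnut_sum g a b K L (\<lambda>t. f t + c * h t)) (\<lambda>t. f t + c * h t)) / 4"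
proof -
  let ?W = "walnut_sum g a b K L"
  note W = walnut_sum_L2[OF b g bes]
  have "L2_inner (?W (\<lambda>t. f t + c * h t)) (\<lambda>t. f t + c * h t)
      = L2_inner (?W f) f + cnj c * L2_inner (?W f) h + c * L2_inner (?W h) f + c * cnj c * L2_inner (?W h) h" for c
    by (simp add: walnut_sum_add walnut_sum_cmult L2_inner_add_left L2_inner_add_right L2_inner_cmult_left
        L2_inner_cmult_right L2_add L2_cmult W f h distrib_left)
  moreover have "(\<Sum>c\<in>{1, -1, \<i>, -\<i>}. c * (x + cnj c * y + c * z + c * cnj c * w)) = 4 * y" for x y z w
    by (simp add: complex_eq_iff)
  ultimately show ?thesis by (simp only:) simp
qed

lemma L2_inner_dual: "h \<in> L2 \<Longrightarrow> (\<lambda>f. L2_inner f h) \<in> L2_dual"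
  unfolding L2_dual_def
  by (auto simp: L2_inner_add_left L2_inner_cmult_left mult.commute intro!: exI[of _ "L2_norm h"] order_trans[OF L2_Cauchy_Schwarz])

lemma L2_tendsto_imp_weak:
  assumes "L2_tendsto u h F"
  shows "L2_weak_tendsto u h F"
  unfolding L2_weak_tendsto_def
proof (intro conjI ballI)
  show h: "h \<in> L2" and u: "\<forall>\<^sub>F i in F. u i \<in> L2" using assms by (auto simp: L2_tendsto_def)
  fix \<phi> assume "\<phi> \<in> L2_dual"
  then obtain C where \<phi>: "\<forall>f\<in>L2. \<forall>h\<in>L2. \<phi> (\<lambda>t. f t + h t) = \<phi> f + \<phi> h"
      "\<forall>c. \<forall>f\<in>L2. \<phi> (\<lambda>t. c * f t) = c * \<phi> f" "\<forall>f\<in>L2. cmod (\<phi> f) \<le> C * L2_norm f"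
    unfolding L2_dual_def by blast
  have lim: "((\<lambda>i. C * L2_norm (\<lambda>t. u i t - h t)) \<longlongrightarrow> 0) F"
    using assms tendsto_mult_left[of _ 0 F C] by (simp add: L2_tendsto_def)
  have "\<forall>\<^sub>F i in F. norm (\<phi> (u i) - \<phi> h) \<le> C * L2_norm (\<lambda>t. u i t - h t)"
    using u
  proof eventually_elim
    case (elim i)
    have "\<phi> (\<lambda>t. u i t + (-1) * h t) = \<phi> (u i) + \<phi> (\<lambda>t. (-1) * h t)"
      using bspec[OF bspec[OF \<phi>(1) elim] L2_cmult[OF h, of "-1"]] .
    also have "\<phi> (\<lambda>t. (-1) * h t) = (-1) * \<phi> h" using bspec[OF spec[OF \<phi>(2)] h] .
    finally have "\<phi> (u i) - \<phi> h = \<phi> (\<lambda>t. u i t - h t)" by simp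
    then show ?case using bspec[OF \<phi>(3) L2_diff[OF elim h]] by simp
  qed
  then show "((\<lambda>i. \<phi> (u i)) \<longlongrightarrow> \<phi> h) F"
    by (subst LIM_zero_iff[symmetric]) (rule Lim_null_comparison[OF _ lim])
qed

text \<open>The existence of the limit justifies the choice in the definition of \<open>frame_op\<close>.\<close>

lemma frame_op_image:
  assumes bes: "bessel (gabor g a b) B" and f: "f \<in> L2"
  shows "frame_image (gabor g a b) f (frame_op g a b f)"
proof -
  have "\<exists>h. L2_tendsto (\<lambda>I t. \<Sum>p\<in>I. L2_inner f (gabor g a b p) * gabor g a b p t) h (finite_subsets_at_top UNIV)"
    using bessel_synthesis_converges[OF assms] by blast
  from frame_image_of_tendsto[OF assms someI_ex[OF this]] show ?thesis
    unfolding frame_op_def .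
qed

lemma frame_op_inner_self:
  assumes bes: "bessel (gabor g a b) B" and f: "f \<in> L2"
  shows "L2_inner (frame_op g a b f) f = of_real (\<Sum>\<^sub>\<infinity>p. (cmod (L2_inner f (gabor g a b p)))\<^sup>2)"
proof -
  have "((\<lambda>p. L2_inner f (gabor g a b p) * cnj (L2_inner f (gabor g a b p))) has_sum L2_inner (frame_op g a b f) f) UNIV"
    using frame_op_image[OF assms] f by (simp add: frame_image_def)
  then have "((\<lambda>p. complex_of_real ((cmod (L2_inner f (gabor g a b p)))\<^sup>2)) has_sum L2_inner (frame_op g a b f) f) UNIV"
    by (simp only: complex_norm_square)
  moreover have "((\<lambda>p. complex_of_real ((cmod (L2_inner f (gabor g a b p)))\<^sup>2)) has_sum
      of_real (\<Sum>\<^sub>\<infinity>p. (cmod (L2_inner f (gabor g a b p)))\<^sup>2)) UNIV"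
    by (intro has_sum_of_real has_sum_infsum bessel_summable[OF assms])
  ultimately show ?thesis by (rule has_sum_unique)
qed

lemma walnut_inner_self:
  assumes b: "0 < b" and g: "g \<in> L2" and bes: "bessel (gabor g a b) B" and f: "f \<in> L2"
  shows "L2_inner (walnut_sum g a b K L f) f =
    (\<Sum>k=-L..K. LINT t|lborel. cnj (f t) * f (t - of_int k / b) * walnut_coeff g a b k t)"
proof -
  have "L2_inner (walnut_sum g a b K L f) f = (\<Sum>k=-L..K. L2_inner (walnut_term g a b k f) f)"
    unfolding walnut_sum_eq by (rule L2_inner_sum_left[OF walnut_term_L2[OF b g bes f] f])
  also have "\<dots> = (\<Sum>k=-L..K. LINT t|lborel. cnj (f t) * f (t - of_int k / b) * walnut_coeff g a b k t)"
    unfolding L2_inner_def walnut_term_def by (simp only: mult_ac)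
  finally show ?thesis .
qed

theorem theorem5p7:
  fixes a b :: real and g :: "real \<Rightarrow> complex"
  assumes "a > 0" and "b > 0" and "g \<in> L2" and "preframe g a b"
  shows "TFAE
    [\<forall>f\<in>L2. \<exists>h. L2_tendsto (\<lambda>(K, L). walnut_sum g a b K L f) h (at_top \<times>\<^sub>F at_top),
     \<forall>f\<in>L2. \<exists>h. L2_weak_tendsto (\<lambda>(K, L). walnut_sum g a b K L f) h (at_top \<times>\<^sub>F at_top),
     (SUP (K, L)\<in>UNIV. L2_opnorm (walnut_sum g a b K L)) < \<infinity>,
     \<forall>f\<in>L2. ((\<lambda>(K, L). 1 / of_real b * L2_inner (walnut_sum g a b K L f) f)
        \<longlongrightarrow> L2_inner (frame_op g a b f) f) (at_top \<times>\<^sub>F at_top),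
     \<forall>f\<in>L2. ((\<lambda>(K, L). 1 / of_real b *
           (\<Sum>k = -L..K. LINT t|lborel. cnj (f t) * f (t - of_int k / b) * walnut_coeff g a b k t))
        \<longlongrightarrow> of_real (\<Sum>\<^sub>\<infinity>p. (cmod (L2_inner f (gabor g a b p)))\<^sup>2))
        (at_top \<times>\<^sub>F (at_top :: int filter))]"
    (is "TFAE [?norm, ?weak, ?bounded, ?form, ?series]")
proof -
  note b = \<open>b > 0\<close> and g = \<open>g \<in> L2\<close>
  obtain B where bes: "bessel (gabor g a b) B" using preframe_bessel[OF g \<open>preframe g a b\<close>] .
  note bounded_iff = walnut_opnorm_finite_iff[OF b g bes]
  have limit: "L2_tendsto (\<lambda>(K, L). walnut_sum g a b K L f) (\<lambda>t. of_real b * frame_op g a b f t) (at_top \<times>\<^sub>F at_top)"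
    if ?bounded and f: "f \<in> L2" for f
  proof -
    obtain R where "0 \<le> R" "\<And>K L f. f \<in> L2 \<Longrightarrow> L2_norm (walnut_sum g a b K L f) \<le> R * L2_norm f"
      using \<open>?bounded\<close> bounded_iff by blast
    from walnut_tendsto_of_bounded[OF b g bes this f frame_op_image[OF bes f]] show ?thesis .
  qed
  have 31: "?norm" if ?bounded using limit[OF that] by blast
  have 12: "?weak" if ?norm using that L2_tendsto_imp_weak by blast
  have 23: "?bounded" if ?weak
    unfolding bounded_iff
  proof (rule walnut_bounded_of_inner_convergent[OF b g bes])
    fix f h :: "real \<Rightarrow> complex" assume f: "f \<in> L2" and h: "h \<in> L2"
    obtain s where "L2_weak_tendsto (\<lambda>(K, L). walnut_sum g a b K L f) s (at_top \<times>\<^sub>F at_top)"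
      using \<open>?weak\<close> f by blast
    then have "\<forall>\<phi>\<in>L2_dual. ((\<lambda>x. \<phi> ((\<lambda>(K, L). walnut_sum g a b K L f) x)) \<longlongrightarrow> \<phi> s) (at_top \<times>\<^sub>F at_top)"
      unfolding L2_weak_tendsto_def by (elim conjE)
    from bspec[OF this L2_inner_dual[OF h]]
    show "\<exists>l. ((\<lambda>(K, L). L2_inner (walnut_sum g a b K L f) h) \<longlongrightarrow> l) (at_top \<times>\<^sub>F at_top)"
      by (auto simp: case_prod_unfold)
  qed
  have 34: "?form" if ?bounded
  proof
    fix f assume f: "f \<in> L2"
    have "((\<lambda>x. 1 / of_real b * L2_inner ((\<lambda>(K, L). walnut_sum g a b K L f) x) f)
        \<longlongrightarrow> 1 / of_real b * L2_inner (\<lambda>t. of_real b * frame_op g a b f t) f) (at_top \<times>\<^sub>F at_top)"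
      by (intro tendsto_intros L2_tendsto_inner[OF limit[OF that f] f])
    then show "((\<lambda>(K, L). 1 / of_real b * L2_inner (walnut_sum g a b K L f) f)
        \<longlongrightarrow> L2_inner (frame_op g a b f) f) (at_top \<times>\<^sub>F at_top)"
      using b by (simp add: L2_inner_cmult_left case_prod_unfold)
  qed
  have 43: "?bounded" if ?form
    unfolding bounded_iff
  proof (rule walnut_bounded_of_inner_convergent[OF b g bes])
    fix f h :: "real \<Rightarrow> complex" assume f: "f \<in> L2" and h: "h \<in> L2"
    have diag: "((\<lambda>(K, L). L2_inner (walnut_sum g a b K L u) u) \<longlongrightarrow> of_real b * L2_inner (frame_op g a b u) u) (at_top \<times>\<^sub>F at_top)"
      if u: "u \<in> L2" for u
      using tendsto_mult_left[OF bspec[OF \<open>?form\<close> u], of "of_real b"] b by (simp add: case_prod_unfold)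
    let ?u = "\<lambda>c t. f t + c * h t"
    have "((\<lambda>(K, L). (\<Sum>c\<in>{1, -1, \<i>, -\<i>}. c * L2_inner (walnut_sum g a b K L (?u c)) (?u c)) / 4)
      \<longlongrightarrow> (\<Sum>c\<in>{1, -1, \<i>, -\<i>}. c * (of_real b * L2_inner (frame_op g a b (?u c)) (?u c))) / 4) (at_top \<times>\<^sub>F at_top)"
      unfolding case_prod_unfold
      by (intro tendsto_divide tendsto_sum tendsto_mult tendsto_const diag[unfolded case_prod_unfold] L2_add L2_cmult f h) simp
    then show "\<exists>l. ((\<lambda>(K, L). L2_inner (walnut_sum g a b K L f) h) \<longlongrightarrow> l) (at_top \<times>\<^sub>F at_top)"
      unfolding walnut_polarization[OF b g bes f h] by blast
  qed
  have 45: "?form \<longleftrightarrow> ?series"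
    by (rule ball_cong[OF refl]) (simp only: walnut_inner_self[OF b g bes] frame_op_inner_self[OF bes])
  have "?norm \<longleftrightarrow> ?bounded" by (rule iffI) (rule 23[OF 12], assumption, rule 31)
  moreover have "?weak \<longleftrightarrow> ?bounded" by (rule iffI) (rule 23, assumption, rule 12[OF 31])
  moreover have "?form \<longleftrightarrow> ?bounded" by (rule iffI) (rule 43, assumption, rule 34)
  moreover note 45[symmetric]
  ultimately show ?thesis unfolding TFAE_def by (simp only: list.set ball_simps simp_thms)
qed

end
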